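(* Let $m\in\mathbb{N}$ and let $\alpha^{(\ell)}=\{\alpha^{(\ell)}_k\}_{k\in\mathbb{Z}}$, $\ell=1,2$, be two sequences of $m\times m$ matrices with complex entries such that $\|\alpha^{(\ell)}_k\|_{\mathbb{C}^{m\times m}}<1$ for $k\in\mathbb{Z}$, $\ell=1,2$. Let $k_0\in\mathbb{Z}$ and $N\in\mathbb{N}$. Let $g^{(\ell)}$, $h^{(\ell)}$ be the entries of the Green's matrix, defined in the context, of the full-lattice CMV operator associated with $\alpha^{(\ell)}$. Then the following hold. $(i)$ If either $h^{(1)}(0,k_0)$ or $h^{(2)}(0,k_0)$ is invertible and $$\|g^{(1)}(z,k_0)-g^{(2)}(z,k_0)\|_{\mathbb{C}^{m\times m}}+\|h^{(1)}(z,k_0)-h^{(2)}(z,k_0)\|_{\mathbb{C}^{m\times m}}=o(z^N)\quad\text{as } z\to0,$$ then $\alpha^{(1)}_k=\alpha^{(2)}_k$ for $k_0-N\le k\le k_0+N+1$. $(ii)$ If $\alpha^{(1)}_{k_0}=\alpha^{(2)}_{k_0}$, $\alpha^{(1)}_{k_0}$ is invertible, and $$\|g^{(1)}(z,k_0-1)-g^{(2)}(z,k_0-1)\|_{\mathbb{C}^{m\times m}}+\|g^{(1)}(z,k_0)-g^{(2)}(z,k_0)\|_{\mathbb{C}^{m\times m}}=o(z^N)\quad\text{as } z\to0,$$ then $\alpha^{(1)}_k=\alpha^{(2)}_k$ for $k_0-N-1\le k\le k_0+N+1$.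
   Context: $\|\cdot\|_{\mathbb{C}^{m\times m}}$ is the operator norm induced by the Euclidean norm on $\mathbb{C}^m$. Given a sequence $\alpha=\{\alpha_k\}_{k\in\mathbb{Z}}\subset\mathbb{C}^{m\times m}$ with $\|\alpha_k\|<1$, set $\rho_k=(I_m-\alpha_k^*\alpha_k)^{1/2}$, $\widetilde\rho_k=(I_m-\alpha_k\alpha_k^* )^{1/2}$, and let $\Theta_k=\begin{pmatrix}-\alpha_k&\widetilde\rho_k\\ \rho_k&\alpha_k^*\end{pmatrix}$ (a unitary $2m\times2m$ matrix). On $\ell^2(\mathbb{Z})^m$ ($\mathbb{C}^m$-valued square-summable sequences) define unitary block-diagonal operators $\mathbb{V},\mathbb{W}$: $\mathbb{V}$ acts on the coordinates $(2k-1,2k)$ by $\Theta_{2k}$, and $\mathbb{W}$ acts on the coordinates $(2k,2k+1)$ by $\Theta_{2k+1}$, for all $k\in\mathbb{Z}$. The full-lattice CMV operator is the unitary operator $\mathbb{U}=\mathbb{V}\mathbb{W}$ on $\ell^2(\mathbb{Z})^m$. For $|z|<1$, $(\mathbb{U}-zI)^{-1}(k,k')\in\mathbb{C}^{m\times m}$ denotes the $(k,k')$ block of the matrix of $(\mathbb{U}-zI)^{-1}$ in the standard basis. For $k\in\mathbb{Z}$, $|z|<1$, put $$g(z,k)=(\mathbb{U}-zI)^{-1}(k,k),\qquad h(z,k)=\begin{cases}(\mathbb{U}-zI)^{-1}(k-1,k),&k\text{ odd},\\(\mathbb{U}-zI)^{-1}(k,k-1),&k\text{ even};\end{cases}$$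 $g^{(\ell)},h^{(\ell)}$ are these functions for $\alpha=\alpha^{(\ell)}$. *)

theory Defs
  imports "HOL-Analysis.Analysis" "HOL-Library.Landau_Symbols"
begin

definition op_norm :: "complex^'m^'m \<Rightarrow> real" where
  "op_norm A = onorm (\<lambda>x. A *v x)"

definition adj_mat :: "complex^'m^'m \<Rightarrow> complex^'m^'m" where
  "adj_mat A = (\<chi> i j. cnj (A $ j $ i))"

definition psd_mat :: "complex^'m^'m \<Rightarrow> bool" where
  "psd_mat A \<longleftrightarrow> adj_mat A = A \<and> (\<forall>x. 0 \<le> Re (\<Sum>i\<in>UNIV. cnj (x $ i) * (A *v x) $ i))"

text \<open>The positive semidefinite square root; meaningful for positive semidefinite arguments only.\<close>
definition sqrt_mat :: "complex^'m^'m \<Rightarrow> complex^'m^'m" where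
  "sqrt_mat A = (THE B. psd_mat B \<and> B ** B = A)"

definition rho :: "complex^'m^'m \<Rightarrow> complex^'m^'m" where
  "rho a = sqrt_mat (mat 1 - adj_mat a ** a)"

definition rho_tilde :: "complex^'m^'m \<Rightarrow> complex^'m^'m" where
  "rho_tilde a = sqrt_mat (mat 1 - a ** adj_mat a)"

text \<open>A \<open>2m \<times> 2m\<close> matrix, kept as a \<open>2 \<times> 2\<close> array of \<open>m \<times> m\<close> blocks.\<close>
definition Theta :: "complex^'m^'m \<Rightarrow> ((complex^'m)^'m)^2^2" where
  "Theta a = vector [vector [- a, rho_tilde a], vector [rho a, adj_mat a]]"

definition ell2 :: "(int \<Rightarrow> complex^'m) set" where
  "ell2 = {f. (\<lambda>k. (norm (f k))\<^sup>2) summable_on UNIV}"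

text \<open>The operators are given by their coordinate formulas on all sequences; only their
  restrictions to \<^const>\<open>ell2\<close> matter.
  In \<open>cmv_V\<close> an even coordinate \<open>n = 2k\<close> is the second, and an odd coordinate \<open>n = 2k - 1\<close>
  the first, of the pair \<open>(2k - 1, 2k)\<close> on which \<open>Theta (\<alpha> (2k))\<close> acts. In \<open>cmv_W\<close> the pairs
  are \<open>(2k, 2k + 1)\<close> with \<open>Theta (\<alpha> (2k + 1))\<close>.\<close>
definition cmv_V :: "(int \<Rightarrow> complex^'m^'m) \<Rightarrow> (int \<Rightarrow> complex^'m) \<Rightarrow> int \<Rightarrow> complex^'m" where
  "cmv_V \<alpha> f n =
     (if even n
      then Theta (\<alpha> n) $ 2 $ 1 *v f (n - 1) + Theta (\<alpha> n) $ 2 $ 2 *v f n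
      else Theta (\<alpha> (n + 1)) $ 1 $ 1 *v f n + Theta (\<alpha> (n + 1)) $ 1 $ 2 *v f (n + 1))"

definition cmv_W :: "(int \<Rightarrow> complex^'m^'m) \<Rightarrow> (int \<Rightarrow> complex^'m) \<Rightarrow> int \<Rightarrow> complex^'m" where
  "cmv_W \<alpha> f n =
     (if odd n
      then Theta (\<alpha> n) $ 2 $ 1 *v f (n - 1) + Theta (\<alpha> n) $ 2 $ 2 *v f n
      else Theta (\<alpha> (n + 1)) $ 1 $ 1 *v f n + Theta (\<alpha> (n + 1)) $ 1 $ 2 *v f (n + 1))"

definition cmv_U :: "(int \<Rightarrow> complex^'m^'m) \<Rightarrow> (int \<Rightarrow> complex^'m) \<Rightarrow> int \<Rightarrow> complex^'m" where
  "cmv_U \<alpha> = cmv_V \<alpha> \<circ> cmv_W \<alpha>"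

text \<open>The inverse of \<open>U - zI\<close> as an operator on \<^const>\<open>ell2\<close>. Since \<open>U\<close> is unitary there,
  \<open>U - zI\<close> is a bijection of \<^const>\<open>ell2\<close> for \<open>|z| < 1\<close>.\<close>
definition cmv_resolvent ::
    "(int \<Rightarrow> complex^'m^'m) \<Rightarrow> complex \<Rightarrow> (int \<Rightarrow> complex^'m) \<Rightarrow> int \<Rightarrow> complex^'m" where
  "cmv_resolvent \<alpha> z = inv_into ell2 (\<lambda>f n. cmv_U \<alpha> f n - z *s f n)"

definition unit_seq :: "int \<Rightarrow> 'm \<Rightarrow> int \<Rightarrow> complex^'m" where
  "unit_seq k j = (\<lambda>n. if n = k then axis j 1 else 0)"

definition green :: "(int \<Rightarrow> complex^'m^'m) \<Rightarrow> complex \<Rightarrow> int \<Rightarrow> int \<Rightarrow> complex^'m^'m" where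
  "green \<alpha> z k k' = (\<chi> i j. cmv_resolvent \<alpha> z (unit_seq k' j) k $ i)"

definition g_fun :: "(int \<Rightarrow> complex^'m^'m) \<Rightarrow> complex \<Rightarrow> int \<Rightarrow> complex^'m^'m" where
  "g_fun \<alpha> z k = green \<alpha> z k k"

definition h_fun :: "(int \<Rightarrow> complex^'m^'m) \<Rightarrow> complex \<Rightarrow> int \<Rightarrow> complex^'m^'m" where
  "h_fun \<alpha> z k = (if odd k then green \<alpha> z (k - 1) k else green \<alpha> z k (k - 1))"

end

theory Submission
  imports Defs
begin

text \<open>It suffices to let \<open>z = t\<close> tend to \<open>0\<close> through positive reals. With \<open>g = (U - t)\<inverse>\<close> and
  \<open>q = W g\<close>, the equation \<open>(U - t) g = 1\<close> reads \<open>g = W\<^sup>* q\<close>, \<open>q = V\<^sup>* (1 + t g)\<close>, and it can be solved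
  from the two ends of the lattice: to the right and to the left of the diagonal the blocks of \<open>g\<close>
  and \<open>q\<close> are related by matrix Schur functions \<open>F\<close> and \<open>G\<close>, with Schur parameters
  \<open>\<alpha>\<^sub>k\<^sub>+\<^sub>1, \<alpha>\<^sub>k\<^sub>+\<^sub>2, \<dots>\<close> and \<open>- \<alpha>\<^sub>k\<^sup>*, - \<alpha>\<^sub>k\<^sub>-\<^sub>1\<^sup>*, \<dots>\<close>. For even \<open>k\<close> this gives
  \<open>g(k, k) = F G (1 + t g(k, k))\<close> and a similar formula for \<open>h\<close>. Hence \<open>g\<close> and \<open>h\<close> up to
  \<open>o(t\<^sup>N)\<close> determine \<open>F\<close> and \<open>G\<close> up to that order, and the Schur algorithm recovers one
  coefficient on each side per order. Since only finite orders matter, the Schur functions are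
  replaced by their finite approximants. For odd \<open>k\<close> the factors appear in the opposite order,
  which taking adjoints reduces to the even case.\<close>

subsection \<open>The Banach algebra of complex matrices\<close>

lemma scaleR_matrix_vector: "(c *\<^sub>R A) *v x = c *\<^sub>R (A *v x)" for A :: "complex^'n^'m"
  by (simp add: matrix_vector_mult_def vec_eq_iff scaleR_sum_right)

lemma norm_matrix_vector_le: "norm (A *v x) \<le> op_norm A * norm x" for A :: "complex^'m^'m"
  unfolding op_norm_def by (rule onorm) simp

lemma op_norm_mult_le: "op_norm (A ** B) \<le> op_norm A * op_norm B" for A B :: "complex^'m^'m"
proof -
  have "(*v) (A ** B) = (*v) A \<circ> (*v) B"
    by (simp add: fun_eq_iff matrix_vector_mul_assoc)
  then show ?thesis
    unfolding op_norm_def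
    by (metis onorm_compose matrix_vector_mul_bounded_linear)
qed

lemma norm_entry_le_op_norm: "norm (A $ i $ j) \<le> op_norm A" for A :: "complex^'m^'m"
proof -
  have "norm (A $ i $ j) = norm ((A *v axis j 1) $ i)"
    by (simp add: matrix_vector_mult_def axis_def if_distrib[of "(*) _"] cong: if_cong)
  also have "\<dots> \<le> norm (A *v axis j 1)"
    by (rule Finite_Cartesian_Product.norm_nth_le)
  also have "\<dots> \<le> op_norm A * norm (axis j 1 :: complex^'m)"
    by (rule norm_matrix_vector_le)
  finally show ?thesis
    by simp
qed

lemma norm_le_op_norm: "norm A \<le> op_norm A * real (CARD('m) * CARD('m))" for A :: "complex^'m^'m"
proof -
  have "norm A \<le> (\<Sum>i\<in>UNIV. norm (A $ i))"
    by (simp add: norm_vec_def L2_set_le_sum)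
  also have "\<dots> \<le> (\<Sum>i\<in>UNIV. \<Sum>j\<in>UNIV. norm (A $ i $ j))"
    by (rule sum_mono) (simp add: norm_vec_def L2_set_le_sum)
  also have "\<dots> \<le> (\<Sum>i\<in>(UNIV :: 'm set). \<Sum>j\<in>(UNIV :: 'm set). op_norm A)"
    by (intro sum_mono norm_entry_le_op_norm)
  finally show ?thesis
    by (simp add: mult_ac)
qed

lemma op_norm_le_sum_columns: "op_norm A \<le> (\<Sum>j\<in>UNIV. norm (column j A))" for A :: "complex^'m^'m"
  unfolding op_norm_def
proof (rule onorm_le)
  fix x :: "complex^'m"
  have "norm (A *v x) \<le> (\<Sum>j\<in>UNIV. norm (x $ j *s column j A))"
    unfolding matrix_mult_sum by (rule norm_sum)
  also have "\<dots> = (\<Sum>j\<in>UNIV. norm (x $ j) * norm (column j A))"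
    by (simp add: norm_vec_def norm_mult L2_set_right_distrib)
  also have "\<dots> \<le> (\<Sum>j\<in>UNIV. norm x * norm (column j A))"
    by (intro sum_mono mult_right_mono Finite_Cartesian_Product.norm_nth_le) simp
  finally show "norm (A *v x) \<le> (\<Sum>j\<in>UNIV. norm (column j A)) * norm x"
    by (simp add: sum_distrib_left[symmetric] mult.commute)
qed

typedef 'm cmatrix = "UNIV :: (complex^'m^'m) set"
  morphisms mat_of of_mat ..

setup_lifting type_definition_cmatrix

instantiation cmatrix :: (finite) real_normed_algebra_1
begin

lift_definition zero_cmatrix :: "'a cmatrix" is 0 .
lift_definition one_cmatrix :: "'a cmatrix" is "mat 1" .
lift_definition plus_cmatrix :: "'a cmatrix \<Rightarrow> 'a cmatrix \<Rightarrow> 'a cmatrix" is "(+)" .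
lift_definition minus_cmatrix :: "'a cmatrix \<Rightarrow> 'a cmatrix \<Rightarrow> 'a cmatrix" is "(-)" .
lift_definition uminus_cmatrix :: "'a cmatrix \<Rightarrow> 'a cmatrix" is "uminus" .
lift_definition times_cmatrix :: "'a cmatrix \<Rightarrow> 'a cmatrix \<Rightarrow> 'a cmatrix" is "(**)" .
lift_definition scaleR_cmatrix :: "real \<Rightarrow> 'a cmatrix \<Rightarrow> 'a cmatrix" is "scaleR" .
lift_definition norm_cmatrix :: "'a cmatrix \<Rightarrow> real" is op_norm .

definition dist_cmatrix :: "'a cmatrix \<Rightarrow> 'a cmatrix \<Rightarrow> real" where
  "dist_cmatrix A B = norm (A - B)"
definition sgn_cmatrix :: "'a cmatrix \<Rightarrow> 'a cmatrix" where
  "sgn_cmatrix A = inverse (norm A) *\<^sub>R A"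
definition uniformity_cmatrix :: "('a cmatrix \<times> 'a cmatrix) filter" where
  "uniformity_cmatrix = (INF e\<in>{0<..}. principal {(A, B). dist A B < e})"
definition open_cmatrix :: "'a cmatrix set \<Rightarrow> bool" where
  "open_cmatrix U = (\<forall>A\<in>U. eventually (\<lambda>(A', B). A' = A \<longrightarrow> B \<in> U) uniformity)"

instance
proof
  fix A B C :: "'a cmatrix" and c d :: real and U :: "'a cmatrix set"
  show "A + B + C = A + (B + C)" "A + B = B + A" "0 + A = A" "- A + A = 0" "A - B = A + - B"
    "c *\<^sub>R (A + B) = c *\<^sub>R A + c *\<^sub>R B" "(c + d) *\<^sub>R A = c *\<^sub>R A + d *\<^sub>R A"
    "c *\<^sub>R d *\<^sub>R A = (c * d) *\<^sub>R A" "1 *\<^sub>R A = A"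
    by (transfer; simp add: algebra_simps)+
  show "A * B * C = A * (B * C)"
    by transfer (simp add: matrix_mul_assoc)
  show "(A + B) * C = A * C + B * C"
    by transfer (simp add: matrix_matrix_mult_def vec_eq_iff distrib_right sum.distrib)
  show "A * (B + C) = A * B + A * C"
    by transfer (rule matrix_add_ldistrib)
  show "1 * A = A" "A * 1 = A"
    by (transfer; simp)+
  show "c *\<^sub>R A * B = c *\<^sub>R (A * B)" "A * c *\<^sub>R B = c *\<^sub>R (A * B)"
    by (transfer; simp add: matrix_matrix_mult_def vec_eq_iff scaleR_sum_right)+
  show "(0 :: 'a cmatrix) \<noteq> 1"
    by transfer (auto simp: mat_def vec_eq_iff)
  show "dist A B = norm (A - B)" "sgn A = inverse (norm A) *\<^sub>R A"
    by (simp_all add: dist_cmatrix_def sgn_cmatrix_def)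
  show "uniformity = (INF e\<in>{0<..}. principal {(A :: 'a cmatrix, B). dist A B < e})"
    by (fact uniformity_cmatrix_def)
  show "open U = (\<forall>A\<in>U. eventually (\<lambda>(A', B). A' = A \<longrightarrow> B \<in> U) uniformity)"
    by (fact open_cmatrix_def)
  show "norm A = 0 \<longleftrightarrow> A = 0"
  proof transfer
    show "op_norm A = 0 \<longleftrightarrow> A = 0" for A :: "complex^'a^'a"
      using norm_le_op_norm[of A] by (auto simp: op_norm_def onorm_zero)
  qed
  show "norm (A + B) \<le> norm A + norm B"
    by transfer (simp add: op_norm_def matrix_vector_mult_add_rdistrib onorm_triangle)
  show "norm (c *\<^sub>R A) = \<bar>c\<bar> * norm A"
    by transfer (simp add: op_norm_def scaleR_matrix_vector onorm_scaleR)
  show "norm (A * B) \<le> norm A * norm B"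
    by transfer (rule op_norm_mult_le)
  show "norm (1 :: 'a cmatrix) = 1"
    by transfer (simp add: op_norm_def onorm_id)
qed

end

lemma bounded_linear_of_mat: "bounded_linear (of_mat :: complex^'m^'m \<Rightarrow> 'm cmatrix)"
  by (intro linear_conv_bounded_linear[THEN iffD1] linearI)
     (simp_all add: plus_cmatrix.abs_eq scaleR_cmatrix.abs_eq)

lemma bounded_linear_mat_of: "bounded_linear (mat_of :: 'm::finite cmatrix \<Rightarrow> complex^'m^'m)"
  by (rule bounded_linear_intro[where K = "real (CARD('m) * CARD('m))"])
     (simp_all only: plus_cmatrix.rep_eq scaleR_cmatrix.rep_eq norm_cmatrix.rep_eq norm_le_op_norm)

instance cmatrix :: (finite) banach
proof
  fix X :: "nat \<Rightarrow> 'a cmatrix"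
  assume "Cauchy X"
  then obtain L where "(\<lambda>n. mat_of (X n)) \<longlonglongrightarrow> L"
    using bounded_linear.Cauchy[OF bounded_linear_mat_of]
    by (auto simp: Cauchy_convergent_iff convergent_def)
  then have "(\<lambda>n. of_mat (mat_of (X n))) \<longlonglongrightarrow> of_mat L"
    by (rule bounded_linear.tendsto[OF bounded_linear_of_mat])
  then show "convergent X"
    by (auto simp: mat_of_inverse convergent_def)
qed

subsection \<open>Inverses and square roots in Banach algebras\<close>

definition ring_unit :: "'a::ring_1 \<Rightarrow> bool" where
  "ring_unit x \<longleftrightarrow> (\<exists>y. x * y = 1 \<and> y * x = 1)"

definition ring_inverse :: "'a::ring_1 \<Rightarrow> 'a" where
  "ring_inverse x = (THE y. x * y = 1 \<and> y * x = 1)"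

lemma ring_unitI: "x * y = 1 \<Longrightarrow> y * x = 1 \<Longrightarrow> ring_unit x"
  by (auto simp: ring_unit_def)

lemma ring_unit_one: "ring_unit 1"
  by (rule ring_unitI[of _ 1]) simp_all

lemma ring_inverse_eqI:
  assumes "x * y = 1" and "y * x = 1"
  shows "ring_inverse x = y"
  unfolding ring_inverse_def
proof (rule the_equality)
  fix z
  assume "x * z = 1 \<and> z * x = 1"
  then have "z = z * (x * y)" "(z * x) * y = y"
    using assms by simp_all
  then show "z = y"
    by (simp add: mult.assoc)
qed (use assms in simp)

lemma
  assumes "ring_unit x"
  shows ring_inverse_right: "x * ring_inverse x = 1" and ring_inverse_left: "ring_inverse x * x = 1"
  using assms ring_inverse_eqI unfolding ring_unit_def by metis+

lemma ring_unit_uminus: "ring_unit x \<Longrightarrow> ring_unit (- x)"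
  by (rule ring_unitI[of _ "- ring_inverse x"]) (simp_all add: ring_inverse_left ring_inverse_right)

lemma ring_unit_mult_left_cancel: "ring_unit x \<Longrightarrow> ring_inverse x * (x * y) = y"
  by (simp add: mult.assoc[symmetric] ring_inverse_left)

lemma ring_unit_mult_right_cancel: "ring_unit x \<Longrightarrow> x * (ring_inverse x * y) = y"
  by (simp add: mult.assoc[symmetric] ring_inverse_right)

lemma
  assumes "ring_unit x" "ring_unit y"
  shows ring_unit_mult: "ring_unit (x * y)"
    and ring_inverse_mult: "ring_inverse (x * y) = ring_inverse y * ring_inverse x"
proof -
  have "x * y * (ring_inverse y * ring_inverse x) = 1"
    "ring_inverse y * ring_inverse x * (x * y) = 1"
    using assms by (simp_all add: mult.assoc ring_unit_mult_left_cancel ring_unit_mult_right_cancel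
        ring_inverse_left ring_inverse_right)
  then show "ring_unit (x * y)" "ring_inverse (x * y) = ring_inverse y * ring_inverse x"
    by (auto intro: ring_unitI ring_inverse_eqI)
qed

lemma ring_unit_one_minus:
  fixes x :: "'a::{real_normed_algebra_1,banach}"
  assumes "norm x < 1"
  shows "ring_unit (1 - x)"
proof -
  have "dist (1 + x * y) (1 + x * z) \<le> norm x * dist y z" for y z
    by (simp add: dist_norm right_diff_distrib[symmetric] norm_mult_ineq)
  then obtain y where "1 + x * y = y"
    using banach_fix_type[of "norm x" "\<lambda>y. 1 + x * y"] assms by auto
  then have y: "(1 - x) * y = 1"
    by (simp add: algebra_simps)
  have "dist (1 + y * x) (1 + z * x) \<le> norm x * dist y z" for y z
    by (simp add: dist_norm left_diff_distrib[symmetric] norm_mult_ineq mult.commute[of "norm x"])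
  then obtain z where "1 + z * x = z"
    using banach_fix_type[of "norm x" "\<lambda>z. 1 + z * x"] assms by auto
  then have z: "z * (1 - x) = 1"
    by (simp add: algebra_simps)
  have "z = z * (1 - x) * y"
    by (simp add: mult.assoc y)
  then have "z = y"
    by (simp add: z)
  with y z show ?thesis
    by (auto intro: ring_unitI)
qed

lemma norm_ring_inverse_one_minus_le:
  fixes x :: "'a::{real_normed_algebra_1,banach}"
  assumes "norm x < 1"
  shows "norm (ring_inverse (1 - x)) \<le> 1 / (1 - norm x)"
proof -
  define y where "y = ring_inverse (1 - x)"
  have "y = 1 + x * y"
    using ring_inverse_right[OF ring_unit_one_minus[OF assms]] by (simp add: y_def algebra_simps)
  then have "norm y \<le> 1 + norm x * norm y"
    using norm_triangle_ineq[of 1 "x * y"] norm_mult_ineq[of x y] by simp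
  then show ?thesis
    using assms by (simp add: y_def field_simps)
qed

text \<open>Square roots of \<open>1 - X\<close> are sought in the form \<open>1 - Y\<close>, where \<open>Y\<close> is a fixed point of the
  contraction \<open>Y \<mapsto> (X + Y\<^sup>2) / 2\<close> of a ball of radius less than 1.\<close>

definition one_minus_sqrt :: "'a::real_normed_algebra_1 \<Rightarrow> 'a \<Rightarrow> bool" where
  "one_minus_sqrt X Y \<longleftrightarrow> norm Y < 1 \<and> (1 - Y) * (1 - Y) = 1 - X"

lemma dist_add_square_le:
  fixes X Y Z :: "'a::real_normed_algebra_1"
  assumes "norm Y \<le> \<rho>" "norm Z \<le> \<rho>"
  shows "dist (X + Y * Y) (X + Z * Z) \<le> 2 * \<rho> * dist Y Z"
proof -
  have "Y * Y - Z * Z = Y * (Y - Z) + (Y - Z) * Z"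
    by (simp add: algebra_simps)
  then have "norm (Y * Y - Z * Z) \<le> norm Y * norm (Y - Z) + norm (Y - Z) * norm Z"
    using norm_triangle_mono[OF norm_mult_ineq norm_mult_ineq] by metis
  also have "\<dots> \<le> \<rho> * norm (Y - Z) + norm (Y - Z) * \<rho>"
    using assms by (intro add_mono mult_mono) (auto intro: order_trans[OF norm_ge_zero])
  finally show ?thesis
    by (simp add: dist_norm)
qed

lemma ex_one_minus_sqrt:
  fixes X :: "'a::{real_normed_algebra_1,banach}"
  assumes X: "norm X < 1"
  obtains Y where "one_minus_sqrt X Y"
proof -
  define \<rho> where "\<rho> = 1 - sqrt (1 - norm X)"
  have \<rho>: "0 \<le> \<rho>" "\<rho> < 1" "norm X + \<rho> * \<rho> = 2 * \<rho>"
    using X by (simp_all add: \<rho>_def algebra_simps)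
  define f where "f Y = (1/2) *\<^sub>R (X + Y * Y)" for Y
  have "f ` cball 0 \<rho> \<subseteq> cball 0 \<rho>"
  proof (rule image_subsetI)
    fix Y :: 'a
    assume "Y \<in> cball 0 \<rho>"
    then have Y: "norm Y \<le> \<rho>"
      by simp
    have "norm (X + Y * Y) \<le> norm X + norm Y * norm Y"
      using norm_triangle_mono[OF order_refl norm_mult_ineq] .
    also have "\<dots> \<le> norm X + \<rho> * \<rho>"
      using Y \<rho>(1) by (intro add_left_mono mult_mono) auto
    finally show "f Y \<in> cball 0 \<rho>"
      using \<rho>(3) by (simp add: f_def)
  qed
  moreover have "dist (f Y) (f Z) \<le> \<rho> * dist Y Z" if "Y \<in> cball 0 \<rho>" "Z \<in> cball 0 \<rho>" for Y Z
    using that dist_add_square_le[of Y \<rho> Z X]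
    by (simp add: f_def dist_norm flip: scaleR_diff_right)
  ultimately have "\<exists>!Y\<in>cball 0 \<rho>. f Y = Y"
    using \<rho> by (intro Banach_fix) (auto simp: complete_eq_closed)
  then obtain Y where Y: "norm Y \<le> \<rho>" "f Y = Y"
    by auto
  have "Y + Y = X + Y * Y"
    using arg_cong[OF Y(2), of "\<lambda>y. 2 *\<^sub>R y"] by (simp add: f_def scaleR_2)
  then have "one_minus_sqrt X Y"
    using Y(1) \<rho>(2) by (simp add: one_minus_sqrt_def algebra_simps)
  then show thesis ..
qed

lemma one_minus_sqrt_intertwines:
  assumes Y: "one_minus_sqrt X Y" and Z: "one_minus_sqrt W Z" and a: "a * X = W * a"
  shows "a * Y = Z * a"
proof -
  define D where "D = a * Y - Z * a"
  have YZ: "Y + Y = X + Y * Y" "Z + Z = W + Z * Z"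
    using Y Z by (simp_all add: one_minus_sqrt_def algebra_simps)
  have "D + D = a * (Y + Y) - (Z + Z) * a"
    by (simp add: D_def algebra_simps)
  also have "\<dots> = a * (X + Y * Y) - (W + Z * Z) * a"
    by (simp only: YZ)
  also have "\<dots> = D * Y + Z * D"
    by (simp add: D_def algebra_simps a)
  finally have "norm (2 *\<^sub>R D) = norm (D * Y + Z * D)"
    by (simp add: scaleR_2)
  also have "\<dots> \<le> norm D * norm Y + norm Z * norm D"
    by (rule norm_triangle_mono[OF norm_mult_ineq norm_mult_ineq])
  finally have "norm D * ((1 - norm Y) + (1 - norm Z)) \<le> 0"
    by (simp add: algebra_simps)
  then have "D = 0"
    using Y Z by (simp add: one_minus_sqrt_def mult_le_0_iff)
  then show ?thesis
    by (simp add: D_def)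
qed

subsection \<open>Adjoints and defect operators\<close>

lift_definition adj :: "'m::finite cmatrix \<Rightarrow> 'm cmatrix" is adj_mat .
lift_definition defect :: "'m::finite cmatrix \<Rightarrow> 'm cmatrix" is rho .

lemma adj_mat_simps [simp]:
  fixes A B :: "complex^'m^'m"
  shows "adj_mat (adj_mat A) = A" "adj_mat (A + B) = adj_mat A + adj_mat B"
    "adj_mat (A - B) = adj_mat A - adj_mat B" "adj_mat (- A) = - adj_mat A"
    "adj_mat (c *\<^sub>R A) = c *\<^sub>R adj_mat A"
    "adj_mat (A ** B) = adj_mat B ** adj_mat A" "adj_mat (mat 1 :: complex^'m^'m) = mat 1"
    "adj_mat (0 :: complex^'m^'m) = 0"
  by (auto simp: adj_mat_def vec_eq_iff matrix_matrix_mult_def mat_def mult.commute)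

lemma adj_simps [simp]:
  fixes A B :: "'m::finite cmatrix"
  shows "adj (adj A) = A" "adj (A + B) = adj A + adj B" "adj (A - B) = adj A - adj B"
    "adj (- A) = - adj A" "adj (c *\<^sub>R A) = c *\<^sub>R adj A" "adj (A * B) = adj B * adj A"
    "adj (1 :: 'm cmatrix) = 1" "adj (0 :: 'm cmatrix) = 0"
  by (transfer; simp)+

lemma adj_eq_iff [simp]: "adj A = adj B \<longleftrightarrow> A = B"
  by (metis adj_simps(1))

lemma inner_complex_vec: "x \<bullet> y = Re (\<Sum>i\<in>UNIV. cnj (x $ i) * y $ i)" for x y :: "complex^'m"
  by (simp add: inner_vec_def inner_complex_def)

lemma inner_adj_mat: "(adj_mat A *v x) \<bullet> y = x \<bullet> (A *v y)" for A :: "complex^'m^'m"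
proof -
  have "(\<Sum>i\<in>UNIV. cnj ((adj_mat A *v x) $ i) * y $ i) = (\<Sum>i\<in>UNIV. cnj (x $ i) * (A *v y) $ i)"
    unfolding matrix_vector_mult_def adj_mat_def
    by (simp add: sum_distrib_left sum_distrib_right, subst sum.swap) (simp add: mult_ac)
  then show ?thesis
    by (simp add: inner_complex_vec)
qed

lemma psd_mat_iff: "psd_mat A \<longleftrightarrow> adj_mat A = A \<and> (\<forall>x. 0 \<le> x \<bullet> (A *v x))"
  by (simp add: psd_mat_def inner_complex_vec)

lemma op_norm_adj_mat_le: "op_norm (adj_mat A) \<le> op_norm A" for A :: "complex^'m^'m"
  unfolding op_norm_def[of "adj_mat A"]
proof (rule onorm_le)
  fix x :: "complex^'m"
  define y where "y = adj_mat A *v x"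
  have "norm y * norm y = x \<bullet> (A *v y)"
    by (simp add: y_def inner_adj_mat[symmetric] power2_norm_eq_inner[symmetric] power2_eq_square)
  also have "\<dots> \<le> norm x * norm (A *v y)"
    by (rule norm_cauchy_schwarz)
  also have "\<dots> \<le> norm x * (op_norm A * norm y)"
    by (intro mult_left_mono norm_matrix_vector_le) simp
  finally have "norm y * norm y \<le> (op_norm A * norm x) * norm y"
    by (simp add: mult_ac)
  then show "norm (adj_mat A *v x) \<le> op_norm A * norm x"
    unfolding y_def[symmetric] by (cases "y = 0") (auto simp: op_norm_def onorm_pos_le)
qed

lemma norm_adj [simp]: "norm (adj A) = norm A"
proof (rule antisym)
  show adj_le: "norm (adj A) \<le> norm A" for A :: "'m::finite cmatrix"
    by transfer (rule op_norm_adj_mat_le)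
  show "norm A \<le> norm (adj A)"
    using adj_le[of "adj A"] by simp
qed

lemma norm_adj_mult_self_less_1: "norm a < 1 \<Longrightarrow> norm (adj a * a) < 1"
  using norm_mult_ineq[of "adj a" a] mult_left_le[of "norm a" "norm a"] by simp

lemma adj_ring_inverse: "ring_unit x \<Longrightarrow> adj (ring_inverse x) = ring_inverse (adj x)"
  by (rule ring_inverse_eqI[symmetric])
     (simp_all add: ring_inverse_left ring_inverse_right flip: adj_simps(6))

lemma ring_unit_adj: "ring_unit x \<Longrightarrow> ring_unit (adj x)"
  by (rule ring_unitI[of _ "adj (ring_inverse x)"])
     (simp_all add: ring_inverse_left ring_inverse_right flip: adj_simps(6))

lemma ring_unit_of_mat_iff: "ring_unit (of_mat A) \<longleftrightarrow> invertible A" for A :: "complex^'m^'m"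
proof -
  have "ring_unit (of_mat A) \<longleftrightarrow> (\<exists>B. of_mat A * of_mat B = 1 \<and> of_mat B * of_mat A = 1)"
    unfolding ring_unit_def by (metis mat_of_inverse)
  then show ?thesis
    by (simp add: invertible_def times_cmatrix.abs_eq one_cmatrix.abs_eq of_mat_inject)
qed

lemma commuting_psd_sqrt_unique:
  fixes B C :: "'m::finite cmatrix"
  assumes B: "\<And>x. 0 \<le> x \<bullet> (mat_of B *v x)" and C: "\<And>x. x \<noteq> 0 \<Longrightarrow> 0 < x \<bullet> (mat_of C *v x)"
    and commute: "B * C = C * B" and squares: "B * B = C * C"
  shows "B = C"
proof -
  have "x = 0" if "mat_of (B + C) *v x = 0" for x
  proof -
    have "x \<bullet> (mat_of B *v x) + x \<bullet> (mat_of C *v x) = 0"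
      using that
      by (simp add: plus_cmatrix.rep_eq matrix_vector_mult_add_rdistrib flip: inner_add_right)
    then show ?thesis
      using B[of x] C[of x] by fastforce
  qed
  then have "invertible (mat_of (B + C))"
    by (simp add: invertible_left_inverse matrix_left_invertible_ker)
  then have unit: "ring_unit (B + C)"
    by (simp add: ring_unit_of_mat_iff[symmetric] mat_of_inverse)
  have "(B + C) * (B - C) = 0"
    using commute squares by (simp add: algebra_simps)
  then have "B - C = 0"
    using ring_unit_mult_left_cancel[OF unit, of "B - C"] by simp
  then show ?thesis
    by simp
qed

lemma one_minus_positive_definite:
  fixes Y :: "'m::finite cmatrix"
  assumes "norm Y < 1" and "x \<noteq> 0"
  shows "0 < x \<bullet> (mat_of (1 - Y) *v x)"
proof -
  have "x \<bullet> (mat_of Y *v x) \<le> norm x * norm (mat_of Y *v x)"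
    by (rule norm_cauchy_schwarz)
  also have "\<dots> \<le> norm x * (norm Y * norm x)"
    by (intro mult_left_mono) (simp_all add: norm_cmatrix.rep_eq norm_matrix_vector_le)
  also have "\<dots> < norm x * norm x"
    using assms by simp
  also have "\<dots> = x \<bullet> x"
    by (simp flip: power2_norm_eq_inner power2_eq_square)
  finally show ?thesis
    by (simp add: minus_cmatrix.rep_eq one_cmatrix.rep_eq matrix_vector_mult_diff_rdistrib
        inner_diff_right)
qed

lemma adj_one_minus_sqrt:
  assumes "adj X = X" and Y: "one_minus_sqrt X Y"
  shows "adj Y = Y"
proof -
  have "adj ((1 - Y) * (1 - Y)) = adj (1 - X)"
    using Y by (simp only: one_minus_sqrt_def)
  then have "one_minus_sqrt X (adj Y)"
    using Y by (simp add: one_minus_sqrt_def assms(1))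
  then show ?thesis
    using one_minus_sqrt_intertwines[of X "adj Y" X Y 1] Y by simp
qed

lemma sqrt_mat_one_minus:
  fixes X Y :: "'m::finite cmatrix"
  assumes X: "adj X = X" and Y: "one_minus_sqrt X Y"
  shows "sqrt_mat (mat_of (1 - X)) = mat_of (1 - Y)"
  unfolding sqrt_mat_def
proof (rule the_equality)
  have Y_less: "norm Y < 1" and square: "(1 - Y) * (1 - Y) = 1 - X"
    using Y by (simp_all add: one_minus_sqrt_def)
  note pos = one_minus_positive_definite[OF Y_less]
  have "adj (1 - Y) = 1 - Y"
    by (simp add: adj_one_minus_sqrt[OF X Y])
  then have "psd_mat (mat_of (1 - Y))"
    unfolding psd_mat_iff by (metis adj.rep_eq inner_zero_left less_imp_le order_refl pos)
  moreover have "mat_of (1 - Y) ** mat_of (1 - Y) = mat_of (1 - X)"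
    by (simp add: square flip: times_cmatrix.rep_eq)
  ultimately show "psd_mat (mat_of (1 - Y)) \<and> mat_of (1 - Y) ** mat_of (1 - Y) = mat_of (1 - X)" ..
  fix B
  assume B: "psd_mat B \<and> B ** B = mat_of (1 - X)"
  define C where "C = of_mat B"
  have mat_of_C: "mat_of C = B"
    by (simp add: C_def of_mat_inverse)
  have "mat_of (C * C) = mat_of (1 - X)"
    using B by (simp add: times_cmatrix.rep_eq mat_of_C)
  then have C_square: "C * C = 1 - X"
    by (simp add: mat_of_inject)
  then have X_eq: "X = 1 - C * C"
    by simp
  have "C * X = X * C"
    by (simp add: X_eq algebra_simps)
  then have "C * (1 - Y) = (1 - Y) * C"
    using one_minus_sqrt_intertwines[OF Y Y] by (simp add: algebra_simps)
  then have "C = 1 - Y"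
    by (rule commuting_psd_sqrt_unique[rotated 2])
       (use B pos in \<open>auto simp: psd_mat_iff mat_of_C C_square square\<close>)
  then show "B = mat_of (1 - Y)"
    using mat_of_C by simp
qed

context
  fixes a :: "'m::finite cmatrix"
  assumes contr: "norm a < 1"
begin

lemma defect_eq_one_minus:
  obtains Y where "defect a = 1 - Y" and "one_minus_sqrt (adj a * a) Y"
proof -
  obtain Y where Y: "one_minus_sqrt (adj a * a) Y"
    using ex_one_minus_sqrt[OF norm_adj_mult_self_less_1[OF contr]] .
  then have "sqrt_mat (mat_of (1 - adj a * a)) = mat_of (1 - Y)"
    by (intro sqrt_mat_one_minus) simp_all
  then have "defect a = 1 - Y"
    by transfer (simp add: rho_def)
  with Y that show thesis
    by blast
qed

lemma defect_square: "defect a * defect a = 1 - adj a * a"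
  by (metis defect_eq_one_minus one_minus_sqrt_def)

lemma ring_unit_defect: "ring_unit (defect a)"
  by (metis defect_eq_one_minus one_minus_sqrt_def ring_unit_one_minus)

lemma adj_defect: "adj (defect a) = defect a"
proof -
  obtain Y where Y: "defect a = 1 - Y" "one_minus_sqrt (adj a * a) Y"
    by (rule defect_eq_one_minus)
  then show ?thesis
    using adj_one_minus_sqrt[OF _ Y(2)] by simp
qed

end

lemma defect_intertwines:
  fixes a :: "'m::finite cmatrix"
  assumes contr: "norm a < 1"
  shows "a * defect a = defect (adj a) * a"
proof -
  obtain Y where Y: "defect a = 1 - Y" "one_minus_sqrt (adj a * a) Y"
    by (rule defect_eq_one_minus[OF contr])
  obtain Z where Z: "defect (adj a) = 1 - Z" "one_minus_sqrt (a * adj a) Z"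
    using defect_eq_one_minus[of "adj a"] contr by auto
  have "a * Y = Z * a"
    by (rule one_minus_sqrt_intertwines[OF Y(2) Z(2)]) (simp add: mult.assoc)
  then show ?thesis
    by (simp add: Y(1) Z(1) algebra_simps)
qed

lemma defect_cong: "adj a * a = adj b * b \<Longrightarrow> defect a = defect b"
  by transfer (simp add: rho_def)

lemma defect_uminus [simp]: "defect (- a) = defect a"
  by (rule defect_cong) simp

text \<open>The ratio \<open>X = a (defect a)\<inverse>\<close> satisfies \<open>1 + X\<^sup>* X = (defect a)\<^sup>-\<^sup>2\<close>.\<close>

lemma defect_ratio_inject:
  fixes a b :: "'m::finite cmatrix"
  assumes a: "norm a < 1" and b: "norm b < 1"
    and eq: "a * ring_inverse (defect a) = b * ring_inverse (defect b)"
  shows "a = b"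
proof -
  have ratio: "ring_inverse (1 + adj (c * ring_inverse (defect c)) * (c * ring_inverse (defect c)))
      = defect c * defect c" if c: "norm c < 1" for c :: "'m cmatrix"
  proof (rule ring_inverse_eqI)
    define r where "r = ring_inverse (defect c)"
    note cancel = ring_unit_mult_left_cancel[OF ring_unit_defect[OF c], folded r_def]
      ring_inverse_left[OF ring_unit_defect[OF c], folded r_def]
      ring_unit_mult_right_cancel[OF ring_unit_defect[OF c], folded r_def]
      ring_inverse_right[OF ring_unit_defect[OF c], folded r_def]
    have "adj r = r"
      by (simp add: r_def adj_ring_inverse ring_unit_defect adj_defect c)
    then have "1 + adj (c * r) * (c * r) = 1 + r * (1 - defect c * defect c) * r"
      by (simp add: defect_square[OF c] mult.assoc)
    also have "\<dots> = r * r"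
      by (simp add: algebra_simps cancel)
    finally have "1 + adj (c * r) * (c * r) = r * r" .
    then show "(1 + adj (c * r) * (c * r)) * (defect c * defect c) = 1"
      "defect c * defect c * (1 + adj (c * r) * (c * r)) = 1"
      by (simp_all add: mult.assoc cancel)
  qed
  have "defect a * defect a = defect b * defect b"
    using ratio[OF a] ratio[OF b] eq by simp
  then have "adj a * a = adj b * b"
    by (simp add: defect_square a b)
  then have defects: "defect a = defect b"
    by (rule defect_cong)
  have "a = a * ring_inverse (defect a) * defect a"
    by (simp add: mult.assoc ring_inverse_left ring_unit_defect a)
  also have "\<dots> = b * ring_inverse (defect b) * defect b"
    by (simp add: eq flip: defects)
  also have "\<dots> = b"
    by (simp add: mult.assoc ring_inverse_left ring_unit_defect b)
  finally show ?thesis .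
qed

subsection \<open>Expansions at \<open>0+\<close>\<close>

lemma eventually_at_right_0_1: "eventually (\<lambda>t::real. 0 < t \<and> t < 1) (at_right 0)"
  using eventually_at_right_real[of 0 1] by simp

definition bounded0 :: "(real \<Rightarrow> 'a::real_normed_vector) \<Rightarrow> bool" where
  "bounded0 f \<longleftrightarrow> (\<lambda>t. norm (f t)) \<in> O[at_right 0](\<lambda>_. 1)"

definition eq_upto :: "nat \<Rightarrow> (real \<Rightarrow> 'a::real_normed_vector) \<Rightarrow> (real \<Rightarrow> 'a) \<Rightarrow> bool" where
  "eq_upto N f g \<longleftrightarrow> (\<lambda>t. norm (f t - g t)) \<in> o[at_right 0](\<lambda>t. t ^ N)"

named_theorems bounded0_intros

lemma bounded0_dominated:
  assumes "eventually (\<lambda>t. norm (f t) \<le> h t) (at_right 0)" and "h \<in> O[at_right 0](\<lambda>_. 1)"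
  shows "bounded0 f"
  unfolding bounded0_def
  by (rule landau_o.big_trans[OF landau_o.big_mono assms(2)])
     (use assms(1) in \<open>eventually_elim, simp\<close>)

lemma bounded0_const [bounded0_intros]: "bounded0 (\<lambda>_. c)"
  by (simp add: bounded0_def)

lemma bounded0_add [bounded0_intros]:
  assumes "bounded0 f" "bounded0 g"
  shows "bounded0 (\<lambda>t. f t + g t)"
proof (rule bounded0_dominated)
  show "(\<lambda>t. norm (f t) + norm (g t)) \<in> O[at_right 0](\<lambda>_. 1)"
    using assms unfolding bounded0_def by (rule sum_in_bigo)
qed (simp add: norm_triangle_ineq)

lemma bounded0_uminus [bounded0_intros]: "bounded0 f \<Longrightarrow> bounded0 (\<lambda>t. - f t)"
  by (simp add: bounded0_def)

lemma bounded0_diff [bounded0_intros]: "bounded0 f \<Longrightarrow> bounded0 g \<Longrightarrow> bounded0 (\<lambda>t. f t - g t)"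
  using bounded0_add[OF _ bounded0_uminus, of f g] by simp

lemma bounded0_mult [bounded0_intros]:
  fixes f g :: "real \<Rightarrow> 'a::real_normed_algebra"
  assumes "bounded0 f" "bounded0 g"
  shows "bounded0 (\<lambda>t. f t * g t)"
proof (rule bounded0_dominated)
  show "(\<lambda>t. norm (f t) * norm (g t)) \<in> O[at_right 0](\<lambda>_. 1)"
    using assms unfolding bounded0_def by (rule landau_o.big.mult_in_1)
qed (simp add: norm_mult_ineq)

lemma bounded0_scale [bounded0_intros]:
  assumes "bounded0 f"
  shows "bounded0 (\<lambda>t. t *\<^sub>R f t)"
proof -
  have "(\<lambda>t::real. norm t) \<in> O[at_right 0](\<lambda>_. 1)"
    by (rule landau_o.bigI[OF zero_less_one])
       (use eventually_at_right_0_1 in \<open>eventually_elim, simp\<close>)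
  then show ?thesis
    using assms by (simp add: bounded0_def landau_o.big.mult_in_1)
qed

lemma bounded0_adj [bounded0_intros]: "bounded0 f \<Longrightarrow> bounded0 (\<lambda>t. adj (f t))"
  by (simp add: bounded0_def)

lemma eq_upto_dominated:
  assumes "eventually (\<lambda>t. norm (f t - g t) \<le> h t) (at_right 0)" and "h \<in> o[at_right 0](\<lambda>t. t ^ N)"
  shows "eq_upto N f g"
  unfolding eq_upto_def
  by (rule landau_o.big_small_trans[OF landau_o.big_mono assms(2)])
     (use assms(1) in \<open>eventually_elim, simp\<close>)

lemma eq_upto_refl [simp, intro]: "eq_upto N f f"
  by (simp add: eq_upto_def)

lemma eq_upto_sym: "eq_upto N f g \<Longrightarrow> eq_upto N g f"
  by (simp add: eq_upto_def norm_minus_commute)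

lemma eq_upto_add:
  assumes "eq_upto N f f'" "eq_upto N g g'"
  shows "eq_upto N (\<lambda>t. f t + g t) (\<lambda>t. f' t + g' t)"
proof (rule eq_upto_dominated)
  show "(\<lambda>t. norm (f t - f' t) + norm (g t - g' t)) \<in> o[at_right 0](\<lambda>t. t ^ N)"
    using assms unfolding eq_upto_def by (rule sum_in_smallo)
qed (simp add: norm_diff_triangle_ineq)

lemma eq_upto_trans [trans]: "eq_upto N f g \<Longrightarrow> eq_upto N g h \<Longrightarrow> eq_upto N f h"
  using eq_upto_add[of N f g g h] by (simp add: eq_upto_def)

lemma eq_upto_uminus: "eq_upto N f g \<Longrightarrow> eq_upto N (\<lambda>t. - f t) (\<lambda>t. - g t)"
  by (simp add: eq_upto_def norm_minus_commute)

lemma eq_upto_diff: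
  "eq_upto N f f' \<Longrightarrow> eq_upto N g g' \<Longrightarrow> eq_upto N (\<lambda>t. f t - g t) (\<lambda>t. f' t - g' t)"
  using eq_upto_add[OF _ eq_upto_uminus, of N f f' g g'] by simp

lemma eq_upto_cong:
  assumes "eventually (\<lambda>t. f t = f' t) (at_right 0)" "eventually (\<lambda>t. g t = g' t) (at_right 0)"
  shows "eq_upto N f g \<longleftrightarrow> eq_upto N f' g'"
  unfolding eq_upto_def
  by (rule landau_o.small.in_cong) (use assms in \<open>eventually_elim, simp\<close>)

lemma eq_upto_eventually: "eventually (\<lambda>t. f t = g t) (at_right 0) \<Longrightarrow> eq_upto N f g"
  using eq_upto_cong[of f g g g N] by simp

lemma eq_upto_rearrange: "(\<And>t. f t - g t = f' t - g' t) \<Longrightarrow> eq_upto N f g \<Longrightarrow> eq_upto N f' g'"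
  by (simp add: eq_upto_def)

lemma eq_upto_sandwich:
  fixes b c f' g' :: "real \<Rightarrow> 'a::real_normed_algebra"
  assumes diff: "eventually (\<lambda>t. f t - g t = b t * (f' t - g' t) * c t) (at_right 0)"
    and "bounded0 b" and "eq_upto N f' g'" and "bounded0 c"
  shows "eq_upto N f g"
proof (rule eq_upto_dominated)
  have "norm (b t * (f' t - g' t) * c t) \<le> norm (f' t - g' t) * norm (b t) * norm (c t)" for t
    by (rule order_trans[OF norm_mult_ineq])
       (simp add: norm_mult_ineq mult_right_mono mult.commute[of "norm (f' t - g' t)"])
  with diff show "eventually (\<lambda>t. norm (f t - g t)
      \<le> norm (f' t - g' t) * norm (b t) * norm (c t)) (at_right 0)"
    by (auto elim!: eventually_mono)
  show "(\<lambda>t. norm (f' t - g' t) * norm (b t) * norm (c t)) \<in> o[at_right 0](\<lambda>t. t ^ N)"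
    using assms(2-4) unfolding bounded0_def eq_upto_def
    by (intro landau_o.small_1_mult)
qed

lemma eq_upto_mult:
  fixes f g :: "real \<Rightarrow> 'a::real_normed_algebra_1"
  assumes "eq_upto N f f'" "eq_upto N g g'" "bounded0 f" "bounded0 g'"
  shows "eq_upto N (\<lambda>t. f t * g t) (\<lambda>t. f' t * g' t)"
proof -
  have "eq_upto N (\<lambda>t. f t * g t) (\<lambda>t. f t * g' t)"
    by (rule eq_upto_sandwich[where b = f and c = "\<lambda>_. 1", OF _ assms(3,2) bounded0_const])
       (simp add: algebra_simps)
  also have "eq_upto N (\<lambda>t. f t * g' t) (\<lambda>t. f' t * g' t)"
    by (rule eq_upto_sandwich[where b = "\<lambda>_. 1" and c = g', OF _ bounded0_const assms(1,4)])
       (simp add: algebra_simps)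
  finally show ?thesis .
qed

lemma eq_upto_adj: "eq_upto N f g \<Longrightarrow> eq_upto N (\<lambda>t. adj (f t)) (\<lambda>t. adj (g t))"
  by (simp add: eq_upto_def flip: adj_simps(3))

lemma eq_upto_Suc_scale: "eq_upto (Suc N) (\<lambda>t. t *\<^sub>R f t) (\<lambda>t. t *\<^sub>R g t) \<longleftrightarrow> eq_upto N f g"
proof -
  have "(\<lambda>t::real. \<bar>t\<bar>) \<in> \<Theta>[at_right 0](\<lambda>t. t)"
    by (rule bigthetaI_cong) (use eventually_at_right_0_1 in \<open>eventually_elim, simp\<close>)
  moreover have "eventually (\<lambda>t::real. t \<noteq> 0) (at_right 0)"
    by (simp add: eventually_at_filter)
  ultimately show ?thesis
    by (simp add: eq_upto_def landau_o.small.mult_cancel_left flip: scaleR_diff_right)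
qed

lemma eq_upto_mono:
  assumes "eq_upto N f g" "M \<le> N"
  shows "eq_upto M f g"
  unfolding eq_upto_def
proof (rule landau_o.small_big_trans)
  show "(\<lambda>t. norm (f t - g t)) \<in> o[at_right 0](\<lambda>t. t ^ N)"
    using assms(1) by (simp add: eq_upto_def)
  show "(\<lambda>t::real. t ^ N) \<in> O[at_right 0](\<lambda>t. t ^ M)"
  proof (rule landau_o.big_mono)
    show "eventually (\<lambda>t::real. norm (t ^ N) \<le> norm (t ^ M)) (at_right 0)"
      using eventually_at_right_0_1 by eventually_elim (simp add: power_decreasing assms(2))
  qed
qed

lemma eq_upto_scale: "eq_upto N f g \<Longrightarrow> eq_upto N (\<lambda>t. t *\<^sub>R f t) (\<lambda>t. t *\<^sub>R g t)"
  by (rule eq_upto_mono[of "Suc N"]) (simp_all add: eq_upto_Suc_scale)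

lemma eq_upto_0_const_iff: "eq_upto 0 f (\<lambda>_. c) \<longleftrightarrow> (f \<longlongrightarrow> c) (at_right 0)"
proof -
  have "eq_upto 0 f (\<lambda>_. c) \<longleftrightarrow> ((\<lambda>t. norm (f t - c)) \<longlongrightarrow> 0) (at_right 0)"
    using smalloI_tendsto[of "\<lambda>t. norm (f t - c)" "\<lambda>_. 1" "at_right 0"]
      smalloD_tendsto[of "\<lambda>t. norm (f t - c)" "at_right 0" "\<lambda>_. 1"]
    by (auto simp: eq_upto_def)
  then show ?thesis
    by (simp add: tendsto_norm_zero_iff LIM_zero_iff)
qed

lemma tendsto_eq_upto: "eq_upto N f g \<Longrightarrow> (g \<longlongrightarrow> c) (at_right 0) \<Longrightarrow> (f \<longlongrightarrow> c) (at_right 0)"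
  using eq_upto_trans[of 0 f g] eq_upto_mono[of N f g 0]
  by (simp add: eq_upto_0_const_iff[symmetric])

lemma tendsto_adj: "(f \<longlongrightarrow> c) (at_right 0) \<Longrightarrow> ((\<lambda>t. adj (f t)) \<longlongrightarrow> adj c) (at_right 0)"
  for f :: "real \<Rightarrow> 'm::finite cmatrix"
  using eq_upto_adj[of 0 f "\<lambda>_. c"] by (simp add: eq_upto_0_const_iff)

lemma bounded0_if_tendsto: "(f \<longlongrightarrow> c) (at_right 0) \<Longrightarrow> bounded0 f"
  unfolding bounded0_def by (rule bigoI_tendsto) (auto intro!: tendsto_eq_intros)

lemma tendsto_0_scale:
  assumes "bounded0 f"
  shows "((\<lambda>t. t *\<^sub>R f t) \<longlongrightarrow> 0) (at_right 0)"
proof -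
  have "(\<lambda>t::real. \<bar>t\<bar>) \<in> o[at_right 0](\<lambda>_. 1)"
    by (rule smalloI_tendsto) (auto intro!: tendsto_eq_intros)
  then have "(\<lambda>t. norm (t *\<^sub>R f t)) \<in> o[at_right 0](\<lambda>_. 1)"
    using assms unfolding bounded0_def norm_scaleR by (rule landau_o.small_1_mult)
  then show ?thesis
    using eq_upto_0_const_iff[of "\<lambda>t. t *\<^sub>R f t" 0] by (simp add: eq_upto_def)
qed

lemma eq_upto_0_scale:
  assumes "bounded0 f" "bounded0 g"
  shows "eq_upto 0 (\<lambda>t. t *\<^sub>R f t) (\<lambda>t. t *\<^sub>R g t)"
  using assms[THEN tendsto_0_scale, folded eq_upto_0_const_iff] by (meson eq_upto_sym eq_upto_trans)

definition unit_near0 :: "(real \<Rightarrow> 'a::real_normed_algebra_1) \<Rightarrow> bool" where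
  "unit_near0 f \<longleftrightarrow> eventually (\<lambda>t. ring_unit (f t)) (at_right 0) \<and> bounded0 (\<lambda>t. ring_inverse (f t))"

lemma unit_near0D:
  assumes "unit_near0 f"
  shows "eventually (\<lambda>t. ring_unit (f t)) (at_right 0)" and "bounded0 (\<lambda>t. ring_inverse (f t))"
  using assms by (simp_all add: unit_near0_def)

lemma ring_unit_perturbation:
  fixes x c :: "'a::{real_normed_algebra_1,banach}"
  assumes c: "ring_unit c" and near: "norm (ring_inverse c * (c - x)) \<le> 1 / 2"
  shows "ring_unit x" and "norm (ring_inverse x) \<le> 2 * norm (ring_inverse c)"
proof -
  define e where "e = ring_inverse c * (c - x)"
  have x: "x = c * (1 - e)"
    by (simp add: e_def right_diff_distrib ring_unit_mult_right_cancel[OF c] mult.assoc[symmetric]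
        ring_inverse_right[OF c])
  have e: "norm e < 1" "ring_unit (1 - e)"
    using near ring_unit_one_minus[of e] by (simp_all add: e_def)
  then show "ring_unit x"
    by (simp add: x ring_unit_mult c)
  have "norm (ring_inverse x) = norm (ring_inverse (1 - e) * ring_inverse c)"
    by (simp add: x ring_inverse_mult c e)
  also have "\<dots> \<le> norm (ring_inverse (1 - e)) * norm (ring_inverse c)"
    by (rule norm_mult_ineq)
  also have "\<dots> \<le> 1 / (1 - norm e) * norm (ring_inverse c)"
    using e by (intro mult_right_mono norm_ring_inverse_one_minus_le) auto
  also have "\<dots> \<le> 2 * norm (ring_inverse c)"
    using near by (intro mult_right_mono) (auto simp: e_def field_simps)
  finally show "norm (ring_inverse x) \<le> 2 * norm (ring_inverse c)" .
qed

lemma unit_near0_if_tendsto: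
  fixes f :: "real \<Rightarrow> 'a::{real_normed_algebra_1,banach}"
  assumes f: "(f \<longlongrightarrow> c) (at_right 0)" and c: "ring_unit c"
  shows "unit_near0 f"
proof -
  have "((\<lambda>t. norm (ring_inverse c * (c - f t))) \<longlongrightarrow> 0) (at_right 0)"
    using f by (auto intro!: tendsto_eq_intros)
  then have "eventually (\<lambda>t. norm (ring_inverse c * (c - f t)) < 1 / 2) (at_right 0)"
    by (rule order_tendstoD) simp
  then have near: "eventually (\<lambda>t. ring_unit (f t)
      \<and> norm (ring_inverse (f t)) \<le> 2 * norm (ring_inverse c)) (at_right 0)"
    by eventually_elim (simp add: ring_unit_perturbation[OF c])
  then have "eventually (\<lambda>t. ring_unit (f t)) (at_right 0)"
    by eventually_elim simp
  moreover have "bounded0 (\<lambda>t. ring_inverse (f t))"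
    by (rule bounded0_dominated[where h = "\<lambda>_. 2 * norm (ring_inverse c)"])
       (use near in \<open>eventually_elim, simp_all\<close>)
  ultimately show ?thesis
    by (simp add: unit_near0_def)
qed

lemma
  fixes f :: "real \<Rightarrow> 'a::{real_normed_algebra_1,banach}"
  assumes "(f \<longlongrightarrow> 0) (at_right 0)"
  shows unit_near0_one_plus: "unit_near0 (\<lambda>t. 1 + f t)"
    and unit_near0_one_minus: "unit_near0 (\<lambda>t. 1 - f t)"
  by (rule unit_near0_if_tendsto[of _ 1];
      use assms in \<open>auto intro!: tendsto_eq_intros ring_unit_one\<close>)+

lemma eq_upto_cancel_left:
  assumes "eq_upto N (\<lambda>t. f t * x t) (\<lambda>t. g t * y t)" and "eq_upto N f g"
    and f: "unit_near0 f" and y: "bounded0 y"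
  shows "eq_upto N x y"
proof -
  have "eq_upto N (\<lambda>t. f t * x t) (\<lambda>t. g t * y t)"
    by fact
  also have "eq_upto N (\<lambda>t. g t * y t) (\<lambda>t. f t * y t)"
    by (rule eq_upto_sandwich[where b = "\<lambda>_. 1" and f' = g and g' = f and c = y])
       (simp_all add: assms eq_upto_sym bounded0_const left_diff_distrib)
  finally have "eq_upto N (\<lambda>t. f t * x t) (\<lambda>t. f t * y t)" .
  then show ?thesis
  proof (rule eq_upto_sandwich[rotated 2])
    show "eventually (\<lambda>t. x t - y t
        = ring_inverse (f t) * (f t * x t - f t * y t) * 1) (at_right 0)"
      using unit_near0D(1)[OF f]
      by eventually_elim (simp add: right_diff_distrib ring_unit_mult_left_cancel)
  qed (fact unit_near0D(2)[OF f] bounded0_const)+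
qed

lemma eq_upto_cancel_right:
  assumes "eq_upto N (\<lambda>t. x t * f t) (\<lambda>t. y t * g t)" and "eq_upto N f g"
    and f: "unit_near0 f" and y: "bounded0 y"
  shows "eq_upto N x y"
proof -
  have "eq_upto N (\<lambda>t. x t * f t) (\<lambda>t. y t * g t)"
    by fact
  also have "eq_upto N (\<lambda>t. y t * g t) (\<lambda>t. y t * f t)"
    by (rule eq_upto_sandwich[where b = y and f' = g and g' = f and c = "\<lambda>_. 1"])
       (simp_all add: assms eq_upto_sym bounded0_const right_diff_distrib)
  finally have "eq_upto N (\<lambda>t. x t * f t) (\<lambda>t. y t * f t)" .
  then show ?thesis
  proof (rule eq_upto_sandwich[rotated 2])
    show "eventually (\<lambda>t. x t - y t
        = 1 * (x t * f t - y t * f t) * ring_inverse (f t)) (at_right 0)"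
      using unit_near0D(1)[OF f]
      by eventually_elim (simp add: left_diff_distrib mult.assoc ring_inverse_right)
  qed (fact unit_near0D(2)[OF f] bounded0_const)+
qed

lemma eq_upto_ring_inverse:
  assumes "eq_upto N f g" and f: "unit_near0 f" and g: "unit_near0 g"
  shows "eq_upto N (\<lambda>t. ring_inverse (f t)) (\<lambda>t. ring_inverse (g t))"
proof (rule eq_upto_cancel_left[OF _ assms(1) f unit_near0D(2)[OF g]])
  show "eq_upto N (\<lambda>t. f t * ring_inverse (f t)) (\<lambda>t. g t * ring_inverse (g t))"
    by (rule eq_upto_eventually)
       (use unit_near0D(1)[OF f] unit_near0D(1)[OF g] in
         \<open>eventually_elim, simp add: ring_inverse_right\<close>)
qed

lemma tendsto_ring_inverse:
  fixes f :: "real \<Rightarrow> 'a::{real_normed_algebra_1,banach}"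
  assumes "(f \<longlongrightarrow> c) (at_right 0)" and "ring_unit c"
  shows "((\<lambda>t. ring_inverse (f t)) \<longlongrightarrow> ring_inverse c) (at_right 0)"
  using eq_upto_ring_inverse[of 0 f "\<lambda>_. c"] assms unit_near0_if_tendsto[OF tendsto_const[of c]]
  by (simp add: eq_upto_0_const_iff unit_near0_if_tendsto)

subsection \<open>The matrix Schur algorithm\<close>

definition feedback :: "'m::finite cmatrix \<Rightarrow> 'm cmatrix \<Rightarrow> 'm cmatrix" where
  "feedback a X = X * ring_inverse (1 - a * X)"

definition schur_step :: "'m::finite cmatrix \<Rightarrow> 'm cmatrix \<Rightarrow> 'm cmatrix" where
  "schur_step a X = - adj a + defect a * feedback a X * defect (adj a)"

definition transmission :: "'m::finite cmatrix \<Rightarrow> 'm cmatrix \<Rightarrow> 'm cmatrix" where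
  "transmission a X = defect (adj a) * ring_inverse (1 + X * adj a)"

definition transmission_left :: "'m::finite cmatrix \<Rightarrow> 'm cmatrix \<Rightarrow> 'm cmatrix" where
  "transmission_left a X = ring_inverse (1 + adj a * X) * defect a"

lemma feedback_push_through:
  assumes "ring_unit (1 - a * X)" and "ring_unit (1 - X * a)"
  shows "feedback a X = ring_inverse (1 - X * a) * X"
proof -
  have "(1 - X * a) * feedback a X = X * ((1 - a * X) * ring_inverse (1 - a * X))"
    by (simp add: feedback_def algebra_simps)
  then show ?thesis
    using ring_unit_mult_left_cancel[OF assms(2), of "feedback a X"]
    by (simp add: ring_inverse_right[OF assms(1)])
qed

lemma one_plus_feedback:
  assumes "ring_unit (1 - a * X)" and "ring_unit (1 - X * a)"
  shows "1 + feedback a X * a = ring_inverse (1 - X * a)"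
proof -
  have "1 + feedback a X * a
      = ring_inverse (1 - X * a) * (1 - X * a) + ring_inverse (1 - X * a) * X * a"
    by (simp add: feedback_push_through[OF assms] ring_inverse_left[OF assms(2)])
  then show ?thesis
    by (simp add: algebra_simps)
qed

lemma adj_feedback:
  assumes "ring_unit (1 - a * X)" and "ring_unit (1 - X * a)"
  shows "adj (feedback a X) = feedback (adj a) (adj X)"
  using feedback_push_through[OF assms] assms
  by (simp add: feedback_def[of "adj a"] adj_ring_inverse)

lemma adj_schur_step:
  assumes "norm a < 1" and "ring_unit (1 - a * X)" and "ring_unit (1 - X * a)"
  shows "adj (schur_step a X) = schur_step (adj a) (adj X)"
  using assms adj_defect[of "adj a"]
  by (simp add: schur_step_def adj_feedback adj_defect mult.assoc)

lemma adj_transmission_left: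
  assumes "norm a < 1" and "ring_unit (1 + adj a * X)"
  shows "adj (transmission_left a X) = transmission (adj a) (adj X)"
  using assms by (simp add: transmission_left_def transmission_def adj_ring_inverse adj_defect)

lemma schur_step_diff:
  assumes a: "norm a < 1"
    and X: "ring_unit (1 - a * X)" "ring_unit (1 - X * a)" and Y: "ring_unit (1 - a * Y)"
  shows "(1 - X * a) * ring_inverse (defect a) * (schur_step a X - schur_step a Y)
      * (ring_inverse (defect (adj a)) * (1 - a * Y)) = X - Y"
proof -
  have units: "ring_unit (defect a)" "ring_unit (defect (adj a))"
    using a by (simp_all add: ring_unit_defect)
  have feedback_X: "(1 - X * a) * feedback a X = X"
    by (simp add: feedback_push_through[OF X] ring_unit_mult_right_cancel[OF X(2)])
  have feedback_Y: "feedback a Y * (1 - a * Y) = Y"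
    by (simp add: feedback_def mult.assoc ring_inverse_left[OF Y])
  have "schur_step a X - schur_step a Y = defect a * (feedback a X - feedback a Y) * defect (adj a)"
    by (simp add: schur_step_def algebra_simps)
  then have "(1 - X * a) * ring_inverse (defect a) * (schur_step a X - schur_step a Y)
      * (ring_inverse (defect (adj a)) * (1 - a * Y))
    = (1 - X * a) * (feedback a X - feedback a Y) * (1 - a * Y)"
    by (simp add: mult.assoc ring_unit_mult_left_cancel ring_unit_mult_right_cancel units)
  also have "\<dots> = (1 - X * a) * feedback a X * (1 - a * Y)
      - (1 - X * a) * (feedback a Y * (1 - a * Y))"
    by (simp add: algebra_simps)
  also have "\<dots> = X * (1 - a * Y) - (1 - X * a) * Y"
    by (simp only: feedback_X feedback_Y)
  also have "\<dots> = X - Y"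
    by (simp add: algebra_simps)
  finally show ?thesis .
qed

lemma schur_step_eq_transmission_mult:
  assumes a: "norm a < 1" and X: "ring_unit (1 + X * adj a)" "ring_unit (1 + adj a * X)"
  shows "schur_step (- adj a) X = transmission a X * ((X + a) * ring_inverse (defect a))"
proof -
  define T where "T = ring_inverse (1 + X * adj a)"
  have feedback: "feedback (- adj a) X = T * X"
    using feedback_push_through[of "- adj a" X] X by (simp add: T_def)
  have "schur_step (- adj a) X * defect a
      = a * defect a + defect (adj a) * T * X * (defect a * defect a)"
    by (simp add: schur_step_def feedback algebra_simps)
  also have "\<dots> = defect (adj a) * (a + T * X * (1 - adj a * a))"
    by (simp add: defect_intertwines[OF a] defect_square[OF a] distrib_left mult.assoc)
  also have "a + T * X * (1 - adj a * a) = T * ((1 + X * adj a) * a) + T * X * (1 - adj a * a)"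
    by (simp add: T_def ring_unit_mult_left_cancel[OF X(1)])
  also have "\<dots> = T * (X + a)"
    by (simp add: algebra_simps)
  finally have "schur_step (- adj a) X * defect a * ring_inverse (defect a)
      = transmission a X * ((X + a) * ring_inverse (defect a))"
    by (simp add: transmission_def T_def mult.assoc)
  then show ?thesis
    by (simp add: mult.assoc ring_inverse_right ring_unit_defect a)
qed

fun theta_mult :: "'m::finite cmatrix \<Rightarrow> 'm cmatrix \<times> 'm cmatrix \<Rightarrow> 'm cmatrix \<times> 'm cmatrix" where
  "theta_mult a (x, y) = (- a * x + defect (adj a) * y, defect a * x + adj a * y)"

lemma theta_mult_swap: "theta_mult (- adj a) (y, x) = prod.swap (theta_mult a (x, y))"
  by simp

lemma schur_step_error:
  assumes unit: "ring_unit (1 - a * X)" and theta: "(x, q) = theta_mult (adj a) (y, p)"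
  shows "x - schur_step a X * y = defect a * (1 + feedback a X * a) * (p - X * q)"
proof -
  define e where "e = p - X * q"
  have x: "x = - adj a * y + defect a * p" and q: "q = defect (adj a) * y + a * p"
    using theta by simp_all
  have p: "p = X * q + e"
    by (simp add: e_def)
  have "(1 - a * X) * q = defect (adj a) * y + a * e"
    by (simp add: e_def q algebra_simps)
  then have "q = ring_inverse (1 - a * X) * (defect (adj a) * y + a * e)"
    using ring_unit_mult_left_cancel[OF unit] by metis
  then have "X * q = feedback a X * (defect (adj a) * y + a * e)"
    by (simp add: feedback_def mult.assoc)
  then have "x = - adj a * y + defect a * (feedback a X * (defect (adj a) * y + a * e) + e)"
    by (simp add: x p)
  then show ?thesis
    by (simp add: schur_step_def e_def algebra_simps)
qed

lemma schur_step_error_left: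
  assumes units: "ring_unit (1 + adj a * X)" "ring_unit (1 + X * adj a)"
    and theta: "(p, x) = theta_mult (adj a) (q, y)"
  shows "x - schur_step (- adj a) X * y = transmission a X * (q - X * p)"
proof -
  have "(x, p) = theta_mult (adj (- adj a)) (y, q)"
    using theta by simp
  then have "x - schur_step (- adj a) X * y
      = defect (- adj a) * (1 + feedback (- adj a) X * - adj a) * (q - X * p)"
    by (rule schur_step_error[rotated]) (simp add: units)
  then show ?thesis
    using one_plus_feedback[of "- adj a" X] by (simp add: transmission_def units)
qed

lemma
  fixes X :: "real \<Rightarrow> 'm::finite cmatrix"
  assumes "(X \<longlongrightarrow> 0) (at_right 0)"
  shows eventually_ring_unit_one_minus:
      "eventually (\<lambda>t. ring_unit (1 - a * X t) \<and> ring_unit (1 - X t * a)) (at_right 0)"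
    and eventually_ring_unit_one_plus:
      "eventually (\<lambda>t. ring_unit (1 + a * X t) \<and> ring_unit (1 + X t * a)) (at_right 0)"
  by (intro eventually_conj unit_near0D(1) unit_near0_one_minus unit_near0_one_plus
      tendsto_mult_left_zero tendsto_mult_right_zero assms)+

lemma tendsto_schur_step:
  fixes X :: "real \<Rightarrow> 'm::finite cmatrix"
  assumes "(X \<longlongrightarrow> 0) (at_right 0)"
  shows "((\<lambda>t. schur_step a (X t)) \<longlongrightarrow> - adj a) (at_right 0)"
proof -
  have "((\<lambda>t. ring_inverse (1 - a * X t)) \<longlongrightarrow> ring_inverse 1) (at_right 0)"
    by (rule tendsto_ring_inverse[OF _ ring_unit_one])
       (use assms in \<open>auto intro!: tendsto_eq_intros\<close>)
  then have "((\<lambda>t. feedback a (X t)) \<longlongrightarrow> 0 * ring_inverse 1) (at_right 0)"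
    unfolding feedback_def by (intro tendsto_mult assms)
  then show ?thesis
    unfolding schur_step_def by (auto intro!: tendsto_eq_intros)
qed

lemma eq_upto_schur_step:
  assumes "(X \<longlongrightarrow> 0) (at_right 0)" "(Y \<longlongrightarrow> 0) (at_right 0)" and "eq_upto N X Y"
  shows "eq_upto N (\<lambda>t. schur_step a (X t)) (\<lambda>t. schur_step a (Y t))"
proof -
  have units: "unit_near0 (\<lambda>t. 1 - a * X t)" "unit_near0 (\<lambda>t. 1 - a * Y t)"
    by (intro unit_near0_one_minus tendsto_mult_right_zero assms)+
  show ?thesis
    unfolding schur_step_def feedback_def
    by (intro eq_upto_add eq_upto_mult eq_upto_diff eq_upto_ring_inverse eq_upto_refl assms(3) units
        unit_near0D(2) bounded0_intros assms(1,2)[THEN bounded0_if_tendsto])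
qed

lemma eq_upto_schur_step_inject:
  assumes contr: "norm a < 1" "norm b < 1"
    and lim: "(X \<longlongrightarrow> 0) (at_right 0)" "(Y \<longlongrightarrow> 0) (at_right 0)"
    and eq: "eq_upto N (\<lambda>t. schur_step a (X t)) (\<lambda>t. schur_step b (Y t))"
  shows "a = b" and "eq_upto N X Y"
proof -
  have "- adj a = - adj b"
    using tendsto_eq_upto[OF eq tendsto_schur_step[OF lim(2)]] tendsto_schur_step[OF lim(1)]
    by (intro tendsto_unique[OF trivial_limit_at_right_real])
  then show eq_ab: "a = b"
    by simp
  have "eventually (\<lambda>t. X t - Y t = (1 - X t * a) * ring_inverse (defect a)
      * (schur_step a (X t) - schur_step a (Y t))
      * (ring_inverse (defect (adj a)) * (1 - a * Y t))) (at_right 0)"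
    using eventually_ring_unit_one_minus[OF lim(1), of a]
      eventually_ring_unit_one_minus[OF lim(2), of a]
    by eventually_elim (simp add: schur_step_diff contr)
  then show "eq_upto N X Y"
    by (rule eq_upto_sandwich)
       (intro eq[folded eq_ab] bounded0_intros lim[THEN bounded0_if_tendsto])+
qed

lemma
  fixes X :: "real \<Rightarrow> 'm::finite cmatrix"
  assumes "(X \<longlongrightarrow> 0) (at_right 0)"
  shows tendsto_transmission: "((\<lambda>t. transmission a (X t)) \<longlongrightarrow> defect (adj a)) (at_right 0)"
    and tendsto_transmission_left: "((\<lambda>t. transmission_left a (X t)) \<longlongrightarrow> defect a) (at_right 0)"
proof -
  have tendsto_1: "((\<lambda>t. ring_inverse (f t)) \<longlongrightarrow> 1) (at_right 0)"
    if "(f \<longlongrightarrow> 1) (at_right 0)" for f :: "real \<Rightarrow> 'm cmatrix"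
    using tendsto_ring_inverse[OF that ring_unit_one] by (simp add: ring_inverse_eqI[of 1 1])
  have "((\<lambda>t. ring_inverse (1 + X t * adj a)) \<longlongrightarrow> 1) (at_right 0)"
    "((\<lambda>t. ring_inverse (1 + adj a * X t)) \<longlongrightarrow> 1) (at_right 0)"
    by (rule tendsto_1, use assms in \<open>auto intro!: tendsto_eq_intros\<close>)+
  then show "((\<lambda>t. transmission a (X t)) \<longlongrightarrow> defect (adj a)) (at_right 0)"
    "((\<lambda>t. transmission_left a (X t)) \<longlongrightarrow> defect a) (at_right 0)"
    unfolding transmission_def transmission_left_def by (auto intro!: tendsto_eq_intros)
qed

lemma eq_upto_transmission:
  assumes "(X \<longlongrightarrow> 0) (at_right 0)" "(Y \<longlongrightarrow> 0) (at_right 0)" and "eq_upto N X Y"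
  shows "eq_upto N (\<lambda>t. transmission a (X t)) (\<lambda>t. transmission a (Y t))"
proof -
  have units: "unit_near0 (\<lambda>t. 1 + X t * adj a)" "unit_near0 (\<lambda>t. 1 + Y t * adj a)"
    by (intro unit_near0_one_plus tendsto_mult_left_zero assms)+
  show ?thesis
    unfolding transmission_def
    by (intro eq_upto_add eq_upto_mult eq_upto_ring_inverse eq_upto_refl assms(3) units
        unit_near0D(2) bounded0_intros assms(1,2)[THEN bounded0_if_tendsto])
qed

primrec schur :: "nat \<Rightarrow> (int \<Rightarrow> 'm::finite cmatrix) \<Rightarrow> int \<Rightarrow> real \<Rightarrow> 'm cmatrix" where
  "schur 0 \<alpha> n = (\<lambda>t. 0)"
| "schur (Suc j) \<alpha> n = (\<lambda>t. schur_step (\<alpha> n) (t *\<^sub>R schur j \<alpha> (n + 1) t))"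

lemma bounded0_schur [bounded0_intros]: "bounded0 (schur j \<alpha> n)"
proof (induction j arbitrary: n)
  case (Suc j)
  show ?case
    using bounded0_if_tendsto[OF tendsto_schur_step[OF tendsto_0_scale[OF Suc]]] by simp
qed (simp add: bounded0_const)

lemma tendsto_0_scale_schur: "((\<lambda>t. t *\<^sub>R schur j \<alpha> n t) \<longlongrightarrow> 0) (at_right 0)"
  by (rule tendsto_0_scale[OF bounded0_schur])

lemma tendsto_schur: "0 < j \<Longrightarrow> (schur j \<alpha> n \<longlongrightarrow> - adj (\<alpha> n)) (at_right 0)"
  using tendsto_schur_step[OF tendsto_0_scale_schur] by (cases j) simp_all

lemma schur_inject:
  assumes contr: "\<And>n. norm (\<alpha> n) < 1" "\<And>n. norm (\<beta> n) < 1"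
    and "eq_upto N (schur j \<alpha> n) (schur j \<beta> n)" and "N < j" and "n \<le> m" "m \<le> n + int N"
  shows "\<alpha> m = \<beta> m"
  using assms(3-)
proof (induction N arbitrary: j n)
  case 0
  then obtain i where "j = Suc i"
    by (cases j) auto
  then show ?case
    using 0 eq_upto_schur_step_inject(1)[OF contr tendsto_0_scale_schur tendsto_0_scale_schur]
    by simp
next
  case (Suc N)
  then obtain i where j: "j = Suc i"
    by (cases j) auto
  note step = eq_upto_schur_step_inject[OF contr tendsto_0_scale_schur tendsto_0_scale_schur
      Suc.prems(1)[unfolded j schur.simps]]
  show ?case
  proof (cases "m = n")
    case False
    then show ?thesis
      using Suc.prems j step(2) by (intro Suc.IH[of i "n + 1"]) (auto simp: eq_upto_Suc_scale)
  qed (simp add: step(1))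
qed

subsection \<open>Factorizations of Schur functions\<close>

lemma eq_upto_factors:
  fixes F1 F2 X1 X2 :: "real \<Rightarrow> 'm::finite cmatrix"
  assumes contr: "norm a1 < 1" "norm a2 < 1"
    and lim: "(X1 \<longlongrightarrow> 0) (at_right 0)" "(X2 \<longlongrightarrow> 0) (at_right 0)" and F2: "bounded0 F2"
    and FT: "eq_upto N (\<lambda>t. F1 t * transmission a1 (X1 t)) (\<lambda>t. F2 t * transmission a2 (X2 t))"
    and FT_lim: "((\<lambda>t. F1 t * transmission a1 (X1 t)) \<longlongrightarrow> c) (at_right 0)"
    and c: "ring_unit c"
    and FG: "eq_upto N (\<lambda>t. F1 t * schur_step (- adj a1) (X1 t))
      (\<lambda>t. F2 t * schur_step (- adj a2) (X2 t))"
  shows "a1 = a2" and "eq_upto N X1 X2" and "eq_upto N F1 F2"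
proof -
  define Z where "Z a X t = (X t + a) * ring_inverse (defect a)"
    for a :: "'m cmatrix" and X and t :: real
  have FG_eq: "eventually (\<lambda>t. F t * schur_step (- adj a) (X t)
      = F t * transmission a (X t) * Z a X t) (at_right 0)"
    if "norm a < 1" "(X \<longlongrightarrow> 0) (at_right 0)" for a X F
    using eventually_ring_unit_one_plus[OF that(2), of "adj a"]
    by eventually_elim (simp add: schur_step_eq_transmission_mult that(1) Z_def mult.assoc)
  have lim_Z: "(Z a X \<longlongrightarrow> a * ring_inverse (defect a)) (at_right 0)"
    if "(X \<longlongrightarrow> 0) (at_right 0)" for a X
    unfolding Z_def[abs_def] using that by (auto intro!: tendsto_eq_intros)
  have "eq_upto N (\<lambda>t. F1 t * transmission a1 (X1 t) * Z a1 X1 t)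
      (\<lambda>t. F2 t * transmission a2 (X2 t) * Z a2 X2 t)"
    using FG eq_upto_cong[OF FG_eq[OF contr(1) lim(1), of F1] FG_eq[OF contr(2) lim(2), of F2]]
    by simp
  then have eq_Z: "eq_upto N (Z a1 X1) (Z a2 X2)"
    using FT unit_near0_if_tendsto[OF FT_lim c] bounded0_if_tendsto[OF lim_Z[OF lim(2)]]
    by (rule eq_upto_cancel_left)
  have "a1 * ring_inverse (defect a1) = a2 * ring_inverse (defect a2)"
    using tendsto_eq_upto[OF eq_Z lim_Z[OF lim(2)]] lim_Z[OF lim(1)]
    by (intro tendsto_unique[OF trivial_limit_at_right_real])
  then show eq_a: "a1 = a2"
    by (rule defect_ratio_inject[OF contr])
  show eq_X: "eq_upto N X1 X2"
  proof (rule eq_upto_sandwich[OF always_eventually bounded0_const eq_Z bounded0_const],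
      rule allI)
    show "X1 t - X2 t = 1 * (Z a1 X1 t - Z a2 X2 t) * defect a2" for t
      by (simp add: Z_def eq_a left_diff_distrib mult.assoc ring_inverse_left ring_unit_defect
          contr)
  qed
  have "unit_near0 (\<lambda>t. transmission a2 (X1 t))"
    using contr unit_near0_if_tendsto[OF tendsto_transmission[OF lim(1)]]
    by (simp add: ring_unit_defect)
  then show "eq_upto N F1 F2"
    by (rule eq_upto_cancel_right[OF FT[unfolded eq_a] eq_upto_transmission[OF lim eq_X] _ F2])
qed

text \<open>Each of the two equations determines one of the functions to the order to which the other
  one, multiplied by \<open>t\<close>, is known, which raises the order step by step.\<close>

lemma eq_upto_bootstrap:
  fixes F1 F2 G1 G2 :: "real \<Rightarrow> 'm::finite cmatrix"
  assumes a: "ring_unit a" and bounded: "bounded0 F1" "bounded0 F2" "bounded0 G1" "bounded0 G2"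
    and FG: "eq_upto N (\<lambda>t. F1 t * schur_step (- adj a) (t *\<^sub>R G1 t))
      (\<lambda>t. F2 t * schur_step (- adj a) (t *\<^sub>R G2 t))"
    and GF: "eq_upto N (\<lambda>t. G1 t * schur_step a (t *\<^sub>R F1 t))
      (\<lambda>t. G2 t * schur_step a (t *\<^sub>R F2 t))"
  shows "eq_upto N F1 F2" and "eq_upto N G1 G2"
proof -
  note lim = bounded[THEN tendsto_0_scale]
  have "unit_near0 (\<lambda>t. schur_step (- adj a) (t *\<^sub>R G1 t))"
    using tendsto_schur_step[OF lim(3), of "- adj a"] a by (simp add: unit_near0_if_tendsto)
  then have F_step: "eq_upto n F1 F2"
    if "n \<le> N" "eq_upto n (\<lambda>t. t *\<^sub>R G1 t) (\<lambda>t. t *\<^sub>R G2 t)" for n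
    by (rule eq_upto_cancel_right[OF eq_upto_mono[OF FG that(1)]
          eq_upto_schur_step[OF lim(3,4) that(2)] _ bounded(2)])
  have "unit_near0 (\<lambda>t. schur_step a (t *\<^sub>R F1 t))"
    by (rule unit_near0_if_tendsto[OF tendsto_schur_step[OF lim(1)]])
       (intro ring_unit_uminus ring_unit_adj a)
  then have G_step: "eq_upto n G1 G2"
    if "n \<le> N" "eq_upto n (\<lambda>t. t *\<^sub>R F1 t) (\<lambda>t. t *\<^sub>R F2 t)" for n
    by (rule eq_upto_cancel_right[OF eq_upto_mono[OF GF that(1)]
          eq_upto_schur_step[OF lim(1,2) that(2)] _ bounded(4)])
  have "eq_upto n F1 F2 \<and> eq_upto n G1 G2" if "n \<le> N" for n
    using that
  proof (induction n)
    case 0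
    then show ?case
      by (intro conjI F_step G_step eq_upto_0_scale bounded)
  next
    case (Suc n)
    then show ?case
      by (intro conjI F_step G_step) (simp_all add: eq_upto_Suc_scale)
  qed
  then show "eq_upto N F1 F2" "eq_upto N G1 G2"
    by simp_all
qed

text \<open>Taking adjoints yields both results with the factors in the opposite order.\<close>

lemma eq_upto_adj_schur_step_mult:
  assumes contr: "norm a < 1" "norm b < 1"
    and lim: "(X \<longlongrightarrow> 0) (at_right 0)" "(Y \<longlongrightarrow> 0) (at_right 0)"
    and eq: "eq_upto N (\<lambda>t. schur_step a (X t) * F t) (\<lambda>t. schur_step b (Y t) * G t)"
  shows "eq_upto N (\<lambda>t. adj (F t) * schur_step (adj a) (adj (X t)))
    (\<lambda>t. adj (G t) * schur_step (adj b) (adj (Y t)))"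
proof -
  have adj_eq: "eventually (\<lambda>t. adj (schur_step c (Z t) * H t)
      = adj (H t) * schur_step (adj c) (adj (Z t))) (at_right 0)"
    if "norm c < 1" "(Z \<longlongrightarrow> 0) (at_right 0)" for c Z and H :: "real \<Rightarrow> 'a cmatrix"
    using eventually_ring_unit_one_minus[OF that(2), of c]
    by eventually_elim (simp add: adj_schur_step that(1))
  show ?thesis
    using eq_upto_adj[OF eq]
      eq_upto_cong[OF adj_eq[OF contr(1) lim(1), of F] adj_eq[OF contr(2) lim(2), of G]] by simp
qed

lemma eventually_adj_transmission_left_mult:
  fixes F :: "real \<Rightarrow> 'm::finite cmatrix"
  assumes "norm a < 1" and lim: "(X \<longlongrightarrow> 0) (at_right 0)"
  shows "eventually (\<lambda>t. adj (transmission_left a (X t) * F t)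
    = adj (F t) * transmission (adj a) (adj (X t))) (at_right 0)"
  using eventually_ring_unit_one_plus[OF lim, of "adj a"]
  by eventually_elim (simp add: adj_transmission_left assms(1))

lemma eq_upto_factors_left:
  fixes F1 F2 X1 X2 :: "real \<Rightarrow> 'm::finite cmatrix"
  assumes contr: "norm a1 < 1" "norm a2 < 1"
    and lim: "(X1 \<longlongrightarrow> 0) (at_right 0)" "(X2 \<longlongrightarrow> 0) (at_right 0)" and F2: "bounded0 F2"
    and TF: "eq_upto N (\<lambda>t. transmission_left a1 (X1 t) * F1 t)
      (\<lambda>t. transmission_left a2 (X2 t) * F2 t)"
    and TF_lim: "((\<lambda>t. transmission_left a1 (X1 t) * F1 t) \<longlongrightarrow> c) (at_right 0)"
    and c: "ring_unit c"
    and GF: "eq_upto N (\<lambda>t. schur_step (- adj a1) (X1 t) * F1 t)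
      (\<lambda>t. schur_step (- adj a2) (X2 t) * F2 t)"
  shows "a1 = a2" and "eq_upto N X1 X2" and "eq_upto N F1 F2"
proof -
  have adj_contr: "norm (adj a1) < 1" "norm (adj a2) < 1"
    "norm (- adj a1) < 1" "norm (- adj a2) < 1"
    by (simp_all add: contr)
  have adj_lim: "((\<lambda>t. adj (X1 t)) \<longlongrightarrow> 0) (at_right 0)" "((\<lambda>t. adj (X2 t)) \<longlongrightarrow> 0) (at_right 0)"
    using lim[THEN tendsto_adj] by simp_all
  note adj_TF = eventually_adj_transmission_left_mult[OF contr(1) lim(1), of F1]
    eventually_adj_transmission_left_mult[OF contr(2) lim(2), of F2]
  have FT: "eq_upto N (\<lambda>t. adj (F1 t) * transmission (adj a1) (adj (X1 t)))
      (\<lambda>t. adj (F2 t) * transmission (adj a2) (adj (X2 t)))"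
    using eq_upto_adj[OF TF] eq_upto_cong[OF adj_TF] by simp
  have FT_lim: "((\<lambda>t. adj (F1 t) * transmission (adj a1) (adj (X1 t))) \<longlongrightarrow> adj c) (at_right 0)"
    using tendsto_adj[OF TF_lim] tendsto_cong[OF adj_TF(1)] by simp
  have FG: "eq_upto N (\<lambda>t. adj (F1 t) * schur_step (- adj (adj a1)) (adj (X1 t)))
      (\<lambda>t. adj (F2 t) * schur_step (- adj (adj a2)) (adj (X2 t)))"
    using eq_upto_adj_schur_step_mult[OF adj_contr(3,4) lim GF] by simp
  note factors = eq_upto_factors[OF adj_contr(1,2) adj_lim bounded0_adj[OF F2] FT FT_lim
      ring_unit_adj[OF c] FG]
  show "a1 = a2" "eq_upto N X1 X2" "eq_upto N F1 F2"
    using factors(1) eq_upto_adj[OF factors(2)] eq_upto_adj[OF factors(3)] by simp_all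
qed

lemma eq_upto_bootstrap_left:
  fixes F1 F2 G1 G2 :: "real \<Rightarrow> 'm::finite cmatrix"
  assumes contr: "norm a < 1" and a: "ring_unit a"
    and bounded: "bounded0 F1" "bounded0 F2" "bounded0 G1" "bounded0 G2"
    and GF: "eq_upto N (\<lambda>t. schur_step (- adj a) (t *\<^sub>R G1 t) * F1 t)
      (\<lambda>t. schur_step (- adj a) (t *\<^sub>R G2 t) * F2 t)"
    and FG: "eq_upto N (\<lambda>t. schur_step a (t *\<^sub>R F1 t) * G1 t)
      (\<lambda>t. schur_step a (t *\<^sub>R F2 t) * G2 t)"
  shows "eq_upto N F1 F2" and "eq_upto N G1 G2"
proof -
  note lim = bounded[THEN tendsto_0_scale]
  have adj_contr: "norm (- adj a) < 1"
    by (simp add: contr)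
  have adj_GF: "eq_upto N (\<lambda>t. adj (F1 t) * schur_step (- adj (adj a)) (t *\<^sub>R adj (G1 t)))
      (\<lambda>t. adj (F2 t) * schur_step (- adj (adj a)) (t *\<^sub>R adj (G2 t)))"
    using eq_upto_adj_schur_step_mult[OF adj_contr adj_contr lim(3,4) GF] by simp
  have adj_FG: "eq_upto N (\<lambda>t. adj (G1 t) * schur_step (adj a) (t *\<^sub>R adj (F1 t)))
      (\<lambda>t. adj (G2 t) * schur_step (adj a) (t *\<^sub>R adj (F2 t)))"
    using eq_upto_adj_schur_step_mult[OF contr contr lim(1,2) FG] by simp
  note bootstrap = eq_upto_bootstrap[OF ring_unit_adj[OF a] bounded[THEN bounded0_adj]
      adj_GF adj_FG]
  show "eq_upto N F1 F2" "eq_upto N G1 G2"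
    using bootstrap[THEN eq_upto_adj] by simp_all
qed

subsection \<open>Green's matrices\<close>

text \<open>The reflection \<open>n \<mapsto> 1 - n\<close> of the lattice turns the CMV operator of \<open>\<alpha>\<close> into that of
  \<open>reflect \<alpha>\<close>.\<close>

definition reflect :: "(int \<Rightarrow> 'm::finite cmatrix) \<Rightarrow> int \<Rightarrow> 'm cmatrix" where
  "reflect \<alpha> n = - adj (\<alpha> (2 - n))"

definition schur_left :: "nat \<Rightarrow> (int \<Rightarrow> 'm::finite cmatrix) \<Rightarrow> int \<Rightarrow> real \<Rightarrow> 'm cmatrix" where
  "schur_left j \<alpha> n = schur j (reflect \<alpha>) (2 - n)"

lemma reflect_reflect [simp]: "reflect (reflect \<alpha>) = \<alpha>"
  by (simp add: reflect_def fun_eq_iff)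

lemma norm_reflect [simp]: "norm (reflect \<alpha> n) = norm (\<alpha> (2 - n))"
  by (simp add: reflect_def)

lemma schur_left_Suc:
  "schur_left (Suc j) \<alpha> n = (\<lambda>t. schur_step (- adj (\<alpha> n)) (t *\<^sub>R schur_left j \<alpha> (n - 1) t))"
  by (simp add: schur_left_def reflect_def algebra_simps)

lemma bounded0_schur_left [bounded0_intros]: "bounded0 (schur_left j \<alpha> n)"
  by (simp add: schur_left_def bounded0_schur)

lemma schur_left_inject:
  assumes contr: "\<And>n. norm (\<alpha> n) < 1" "\<And>n. norm (\<beta> n) < 1"
    and "eq_upto N (schur_left j \<alpha> n) (schur_left j \<beta> n)" and "N < j" and "n - int N \<le> m" "m \<le> n"
  shows "\<alpha> m = \<beta> m"
  using schur_inject[of "reflect \<alpha>" "reflect \<beta>" N j "2 - n" "2 - m"] assms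
  by (simp add: schur_left_def reflect_def)

definition forced :: "(int \<Rightarrow> int \<Rightarrow> real \<Rightarrow> 'm::finite cmatrix) \<Rightarrow> int \<Rightarrow> int \<Rightarrow> real \<Rightarrow> 'm cmatrix" where
  "forced g n k t = (if n = k then 1 else 0) + t *\<^sub>R g n k t"

definition off_diagonal :: "(int \<Rightarrow> int \<Rightarrow> 'a) \<Rightarrow> int \<Rightarrow> 'a" where
  "off_diagonal g k = (if odd k then g (k - 1) k else g k (k - 1))"

text \<open>\<open>g n k t\<close> stands for the block \<open>(U - t)\<inverse>(n, k)\<close> and \<open>q n k t\<close> for the block \<open>(n, k)\<close> of
  \<open>W (U - t)\<inverse>\<close>, so that the equations below are \<open>g = W\<^sup>* q\<close> and \<open>q = V\<^sup>* (1 + t g)\<close>.\<close>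

locale green_kernel =
  fixes \<alpha> :: "int \<Rightarrow> 'm::finite cmatrix" and g q :: "int \<Rightarrow> int \<Rightarrow> real \<Rightarrow> 'm cmatrix"
  assumes contr: "norm (\<alpha> n) < 1"
    and bounded_g: "bounded0 (g n k)" and bounded_q: "bounded0 (q n k)"
    and g_eq: "\<lbrakk>odd n; 0 \<le> t; t < 1\<rbrakk> \<Longrightarrow>
      (g (n - 1) k t, g n k t) = theta_mult (adj (\<alpha> n)) (q (n - 1) k t, q n k t)"
    and q_eq: "\<lbrakk>even n; 0 \<le> t; t < 1\<rbrakk> \<Longrightarrow>
      (q (n - 1) k t, q n k t) = theta_mult (adj (\<alpha> n)) (forced g (n - 1) k t, forced g n k t)"
begin

lemma bounded_forced: "bounded0 (forced g n k)"
  unfolding forced_def[abs_def] by (intro bounded0_intros bounded_g)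

lemma green_kernel_reflect:
  "green_kernel (reflect \<alpha>) (\<lambda>n k. g (1 - n) (1 - k)) (\<lambda>n k. q (1 - n) (1 - k))"
proof
  fix n k :: int and t :: real
  show "norm (reflect \<alpha> n) < 1"
    by (simp add: contr)
  have reflected: "adj (reflect \<alpha> n) = - adj (adj (\<alpha> (2 - n)))"
    by (simp add: reflect_def)
  assume t: "0 \<le> t" "t < 1"
  show "(g (1 - (n - 1)) (1 - k) t, g (1 - n) (1 - k) t)
      = theta_mult (adj (reflect \<alpha> n)) (q (1 - (n - 1)) (1 - k) t, q (1 - n) (1 - k) t)" if "odd n"
    unfolding reflected theta_mult_swap using g_eq[of "2 - n" t "1 - k"] that t by simp
  have "forced (\<lambda>n k. g (1 - n) (1 - k)) m k t = forced g (1 - m) (1 - k) t" for m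
    by (simp add: forced_def)
  then show "(q (1 - (n - 1)) (1 - k) t, q (1 - n) (1 - k) t)
      = theta_mult (adj (reflect \<alpha> n)) (forced (\<lambda>n k. g (1 - n) (1 - k)) (n - 1) k t,
          forced (\<lambda>n k. g (1 - n) (1 - k)) n k t)" if "even n"
    unfolding reflected theta_mult_swap using q_eq[of "2 - n" t "1 - k"] that t by simp
qed (intro bounded_g bounded_q)+

definition incoming :: "int \<Rightarrow> int \<Rightarrow> real \<Rightarrow> 'm cmatrix" where
  "incoming n k = (if even n then g n k else q n k)"

definition outgoing :: "int \<Rightarrow> int \<Rightarrow> real \<Rightarrow> 'm cmatrix" where
  "outgoing n k = (if even n then q n k else forced g n k)"

lemma incoming_outgoing_step:
  assumes "k \<le> n" and "0 \<le> t" "t < 1"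
  obtains z where "(incoming n k t, z) = theta_mult (adj (\<alpha> (n + 1)))
      (outgoing n k t, (if odd n then t else 1) *\<^sub>R incoming (n + 1) k t)"
    and "outgoing (n + 1) k t = (if odd n then 1 else t) *\<^sub>R z"
proof (cases "even n")
  case True
  then show thesis
    using that[of "g (n + 1) k t"] g_eq[of "n + 1" t k] assms
    by (simp add: incoming_def outgoing_def forced_def)
next
  case False
  then show thesis
    using that[of "q (n + 1) k t"] q_eq[of "n + 1" t k] assms
    by (simp add: incoming_def outgoing_def forced_def)
qed

definition schur_error :: "nat \<Rightarrow> int \<Rightarrow> int \<Rightarrow> real \<Rightarrow> 'm cmatrix" where
  "schur_error j n k t = incoming n k t - schur j \<alpha> (n + 1) t * outgoing n k t"

lemma schur_error_step:
  assumes "k \<le> n"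
  obtains B where "bounded0 B" and "eventually (\<lambda>t. schur_error (Suc j) n k t
      = (if odd n then t else 1) *\<^sub>R (B t * schur_error j (n + 1) k t)) (at_right 0)"
proof
  define F where "F = schur j \<alpha> (n + 2)"
  define a where "a = \<alpha> (n + 1)"
  have lim: "((\<lambda>t. t *\<^sub>R F t) \<longlongrightarrow> 0) (at_right 0)"
    unfolding F_def by (rule tendsto_0_scale_schur)
  define B where "B t = defect a * (1 + feedback a (t *\<^sub>R F t) * a)" for t
  show "bounded0 B"
    unfolding B_def feedback_def
    by (intro bounded0_intros unit_near0D(2) unit_near0_one_minus tendsto_mult_right_zero lim
        bounded0_if_tendsto[OF lim])
  from eventually_ring_unit_one_minus[OF lim, of a] eventually_at_right_0_1
  show "eventually (\<lambda>t. schur_error (Suc j) n k t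
      = (if odd n then t else 1) *\<^sub>R (B t * schur_error j (n + 1) k t)) (at_right 0)"
  proof eventually_elim
    case (elim t)
    define w where "w = (if odd n then t else 1)"
    obtain z where z: "(incoming n k t, z)
        = theta_mult (adj a) (outgoing n k t, w *\<^sub>R incoming (n + 1) k t)"
      "outgoing (n + 1) k t = (if odd n then 1 else t) *\<^sub>R z"
      using incoming_outgoing_step[OF assms, of t] elim unfolding a_def w_def by auto
    have "t *\<^sub>R z = w *\<^sub>R outgoing (n + 1) k t"
      by (simp add: z(2) w_def)
    then have "w *\<^sub>R incoming (n + 1) k t - t *\<^sub>R F t * z = w *\<^sub>R schur_error j (n + 1) k t"
      by (simp add: schur_error_def F_def scaleR_diff_right add.commute flip: mult_scaleR_right)
    then show "schur_error (Suc j) n k t = w *\<^sub>R (B t * schur_error j (n + 1) k t)"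
      using schur_step_error[OF _ z(1), of "t *\<^sub>R F t"] elim
      by (simp add: schur_error_def F_def B_def a_def add.commute)
  qed
qed

text \<open>Of two consecutive steps exactly one gains a factor \<open>t\<close>.\<close>

lemma incoming_eq_upto_step:
  assumes "k \<le> n" and "eq_upto N (\<lambda>t. t *\<^sub>R incoming (n + 2) k t)
      (\<lambda>t. t *\<^sub>R (schur j \<alpha> (n + 3) t * outgoing (n + 2) k t))"
  shows "eq_upto N (incoming n k) (\<lambda>t. schur (Suc (Suc j)) \<alpha> (n + 1) t * outgoing n k t)"
proof -
  obtain B where B: "bounded0 B" "eventually (\<lambda>t. schur_error (Suc (Suc j)) n k t
      = (if odd n then t else 1) *\<^sub>R (B t * schur_error (Suc j) (n + 1) k t)) (at_right 0)"
    using schur_error_step[OF assms(1)] .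
  obtain C where C: "bounded0 C" "eventually (\<lambda>t. schur_error (Suc j) (n + 1) k t
      = (if odd (n + 1) then t else 1) *\<^sub>R (C t * schur_error j (n + 1 + 1) k t)) (at_right 0)"
    using schur_error_step[of k "n + 1"] assms(1) by auto
  from B(2) C(2) have "eventually (\<lambda>t. schur_error (Suc (Suc j)) n k t
      = B t * C t * (t *\<^sub>R schur_error j (n + 2) k t) * 1) (at_right 0)"
    by eventually_elim (simp add: mult.assoc add.commute)
  then show ?thesis
    unfolding schur_error_def scaleR_diff_right
    by (rule eq_upto_sandwich)
       (use assms(2) B(1) C(1) in \<open>simp_all add: bounded0_intros add.commute\<close>)
qed

lemma incoming_eq_upto:
  assumes "k \<le> n" and "2 * N + 2 \<le> j"
  shows "eq_upto N (incoming n k) (\<lambda>t. schur j \<alpha> (n + 1) t * outgoing n k t)"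
  using assms
proof (induction N arbitrary: n j)
  case 0
  then obtain i where j: "j = Suc (Suc i)"
    by (metis add_2_eq_Suc le_iff_add mult_0_right plus_nat.add_0)
  have "bounded0 (incoming m k)" "bounded0 (outgoing m k)" for m
    by (simp_all add: incoming_def outgoing_def bounded_g bounded_q bounded_forced)
  then show ?case
    unfolding j by (intro incoming_eq_upto_step 0(1) eq_upto_0_scale bounded0_intros)
next
  case (Suc N)
  then obtain i where i: "j = Suc (Suc i)" "2 * N + 2 \<le> i"
    by (cases j; cases "j - 1") auto
  show ?case
    unfolding i(1)
  proof (rule incoming_eq_upto_step[OF Suc.prems(1)])
    show "eq_upto (Suc N) (\<lambda>t. t *\<^sub>R incoming (n + 2) k t)
        (\<lambda>t. t *\<^sub>R (schur i \<alpha> (n + 3) t * outgoing (n + 2) k t))"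
      using Suc.IH[of "n + 2" i] Suc.prems(1) i(2)
      by (simp add: eq_upto_Suc_scale add.commute[of _ n])
  qed
qed

lemma g_eq_upto_schur:
  assumes "k \<le> n" "even n" "2 * N + 2 \<le> j"
  shows "eq_upto N (g n k) (\<lambda>t. schur j \<alpha> (n + 1) t * q n k t)"
  using incoming_eq_upto[OF assms(1,3)] assms(2) by (simp add: incoming_def outgoing_def)

lemma q_eq_upto_schur:
  assumes "k \<le> n" "odd n" "2 * N + 2 \<le> j"
  shows "eq_upto N (q n k) (\<lambda>t. schur j \<alpha> (n + 1) t * forced g n k t)"
  using incoming_eq_upto[OF assms(1,3)] assms(2) by (simp add: incoming_def outgoing_def)

lemma g_eq_upto_schur_left:
  assumes "n \<le> k" "odd n" "2 * N + 2 \<le> j"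
  shows "eq_upto N (g n k) (\<lambda>t. schur_left j \<alpha> n t * q n k t)"
  using green_kernel.g_eq_upto_schur[OF green_kernel_reflect, of "1 - k" "1 - n" N j] assms
  by (simp add: schur_left_def)

lemma q_eq_upto_schur_left:
  assumes "n \<le> k" "even n" "2 * N + 2 \<le> j"
  shows "eq_upto N (q n k) (\<lambda>t. schur_left j \<alpha> n t * forced g n k t)"
  using green_kernel.q_eq_upto_schur[OF green_kernel_reflect, of "1 - k" "1 - n" N j] assms
  by (simp add: schur_left_def forced_def)

lemma diagonal_eq_upto_even:
  assumes "even k" "2 * N + 2 \<le> i" "2 * N + 2 \<le> j"
  shows "eq_upto N (g k k)
    (\<lambda>t. schur i \<alpha> (k + 1) t * schur_left j \<alpha> k t * (1 + t *\<^sub>R g k k t))"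
proof -
  have "eq_upto N (g k k) (\<lambda>t. schur i \<alpha> (k + 1) t * q k k t)"
    using assms by (intro g_eq_upto_schur) simp_all
  also have "eq_upto N \<dots> (\<lambda>t. schur i \<alpha> (k + 1) t * (schur_left j \<alpha> k t * forced g k k t))"
    using assms
    by (intro eq_upto_mult eq_upto_refl q_eq_upto_schur_left bounded0_intros bounded_forced)
       simp_all
  finally show ?thesis
    by (simp add: forced_def mult.assoc)
qed

lemma diagonal_eq_upto_odd:
  assumes "odd k" "2 * N + 2 \<le> i" "2 * N + 2 \<le> j"
  shows "eq_upto N (g k k)
    (\<lambda>t. schur_left j \<alpha> k t * schur i \<alpha> (k + 1) t * (1 + t *\<^sub>R g k k t))"
  using green_kernel.diagonal_eq_upto_even[OF green_kernel_reflect, of "1 - k" N j i] assms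
  by (simp add: schur_left_def add.commute)

lemma q_eq_upto_transmission:
  fixes j :: nat and k :: int
  assumes k: "even k" and j: "2 * N + 2 \<le> j"
  defines "X \<equiv> \<lambda>t. t *\<^sub>R schur_left j \<alpha> (k - 1) t"
    and "G \<equiv> schur_left (Suc j) \<alpha> k" and "h \<equiv> g k (k - 1)"
  shows "eq_upto N (q k (k - 1)) (\<lambda>t. transmission (\<alpha> k) (X t) + G t * (t *\<^sub>R h t))"
proof -
  define e where "e t = forced g (k - 1) (k - 1) t - X t * q (k - 1) (k - 1) t" for t
  have lim: "(X \<longlongrightarrow> 0) (at_right 0)"
    unfolding X_def by (intro tendsto_0_scale bounded0_intros)
  have "eq_upto N (g (k - 1) (k - 1)) (\<lambda>t. schur_left j \<alpha> (k - 1) t * q (k - 1) (k - 1) t)"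
    using k j by (intro g_eq_upto_schur_left) simp_all
  then have "eq_upto N (\<lambda>t. t *\<^sub>R g (k - 1) (k - 1) t) (\<lambda>t. X t * q (k - 1) (k - 1) t)"
    using eq_upto_scale by (simp add: X_def)
  then have e: "eq_upto N e (\<lambda>_. 1)"
    by (rule eq_upto_rearrange[rotated]) (simp add: e_def forced_def)
  have "eq_upto N (\<lambda>t. q k (k - 1) t - G t * (t *\<^sub>R h t)) (\<lambda>t. transmission (\<alpha> k) (X t))"
  proof (rule eq_upto_sandwich[OF _ _ e bounded0_const])
    show "bounded0 (\<lambda>t. transmission (\<alpha> k) (X t))"
      by (rule bounded0_if_tendsto[OF tendsto_transmission[OF lim]])
    have "eventually (\<lambda>t. q k (k - 1) t - G t * (t *\<^sub>R h t) = transmission (\<alpha> k) (X t) * e t)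
        (at_right 0)"
      using eventually_at_right_0_1 eventually_ring_unit_one_plus[OF lim, of "adj (\<alpha> k)"]
    proof eventually_elim
      case (elim t)
      then show ?case
        using schur_step_error_left[OF _ _ q_eq[OF k, of t "k - 1"], of "X t"]
        by (simp add: G_def schur_left_Suc X_def h_def e_def forced_def)
    qed
    then show "eventually (\<lambda>t. q k (k - 1) t - G t * (t *\<^sub>R h t) - transmission (\<alpha> k) (X t)
        = transmission (\<alpha> k) (X t) * (e t - 1) * 1) (at_right 0)"
      by eventually_elim (simp add: right_diff_distrib)
  qed
  then show ?thesis
    by (rule eq_upto_rearrange[rotated]) (simp add: algebra_simps)
qed

lemma off_diagonal_eq_upto_even:
  fixes j :: nat and k :: int
  assumes k: "even k" and j: "2 * N + 2 \<le> j"
  defines "F \<equiv> schur j \<alpha> (k + 1)" and "X \<equiv> \<lambda>t. t *\<^sub>R schur_left j \<alpha> (k - 1) t"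
    and "G \<equiv> schur_left (Suc j) \<alpha> k" and "h \<equiv> g k (k - 1)"
  shows "eq_upto N (\<lambda>t. F t * transmission (\<alpha> k) (X t)) (\<lambda>t. h t - t *\<^sub>R (F t * G t * h t))"
proof -
  have lim: "(X \<longlongrightarrow> 0) (at_right 0)"
    unfolding X_def by (intro tendsto_0_scale bounded0_intros)
  have bounded: "bounded0 F" "bounded0 G" "bounded0 h"
    unfolding F_def G_def h_def by (intro bounded0_intros bounded_g)+
  have q: "eq_upto N (q k (k - 1)) (\<lambda>t. transmission (\<alpha> k) (X t) + G t * (t *\<^sub>R h t))"
    unfolding X_def G_def h_def by (rule q_eq_upto_transmission[OF k j])
  have "eq_upto N h (\<lambda>t. F t * q k (k - 1) t)"
    unfolding h_def F_def using k j by (intro g_eq_upto_schur) simp_all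
  also have "eq_upto N \<dots> (\<lambda>t. F t * (transmission (\<alpha> k) (X t) + G t * (t *\<^sub>R h t)))"
    by (intro eq_upto_mult eq_upto_refl q bounded0_intros bounded
        bounded0_if_tendsto[OF tendsto_transmission[OF lim]])
  finally have "eq_upto N (\<lambda>t. F t * (transmission (\<alpha> k) (X t) + G t * (t *\<^sub>R h t))) h"
    by (rule eq_upto_sym)
  then show ?thesis
    by (rule eq_upto_rearrange[rotated]) (simp add: algebra_simps)
qed

lemma off_diagonal_eq_upto_odd:
  fixes j :: nat and k :: int
  assumes k: "odd k" and j: "2 * N + 2 \<le> j"
  defines "F \<equiv> schur j \<alpha> (k + 1)" and "X \<equiv> \<lambda>t. t *\<^sub>R schur_left j \<alpha> (k - 1) t"
    and "h \<equiv> g (k - 1) k"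
  shows "eq_upto N h (\<lambda>t. transmission_left (\<alpha> k) (X t) * F t * (1 + t *\<^sub>R g k k t))"
proof -
  define a where "a = \<alpha> k"
  define T where "T t = ring_inverse (1 + adj a * X t)" for t
  have lim: "(X \<longlongrightarrow> 0) (at_right 0)"
    unfolding X_def by (intro tendsto_0_scale bounded0_intros)
  have unit: "unit_near0 (\<lambda>t. 1 + adj a * X t)"
    by (intro unit_near0_one_plus tendsto_mult_right_zero lim)
  have bounded: "bounded0 F" "bounded0 X" "bounded0 h" "bounded0 T"
    unfolding F_def h_def T_def
    by (intro bounded0_intros bounded_g bounded0_if_tendsto[OF lim] unit_near0D(2)[OF unit])+
  have left: "eq_upto N (q (k - 1) k) (\<lambda>t. X t * h t)"
    using q_eq_upto_schur_left[of "k - 1" k N j] k j by (simp add: X_def h_def forced_def)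
  have right: "eq_upto N (q k k) (\<lambda>t. F t * (1 + t *\<^sub>R g k k t))"
    using q_eq_upto_schur[of k k N j] k j by (simp add: F_def forced_def)
  have "eq_upto N h (\<lambda>t. - adj a * q (k - 1) k t + defect a * q k k t)"
  proof (rule eq_upto_eventually)
    show "eventually (\<lambda>t. h t = - adj a * q (k - 1) k t + defect a * q k k t) (at_right 0)"
      using eventually_at_right_0_1
      by eventually_elim (use g_eq[OF k] in \<open>simp add: h_def a_def\<close>)
  qed
  also have "eq_upto N \<dots> (\<lambda>t. - adj a * (X t * h t) + defect a * (F t * (1 + t *\<^sub>R g k k t)))"
    by (intro eq_upto_add eq_upto_mult eq_upto_refl left right bounded0_intros bounded bounded_g)
  finally have
    combined: "eq_upto N (\<lambda>t. (1 + adj a * X t) * h t) (\<lambda>t. defect a * F t * (1 + t *\<^sub>R g k k t))"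
    by (rule eq_upto_rearrange[rotated]) (simp add: algebra_simps)
  have "eq_upto N h (\<lambda>t. T t * ((1 + adj a * X t) * h t))"
    by (rule eq_upto_eventually)
       (use unit_near0D(1)[OF unit] in
         \<open>eventually_elim, simp add: T_def ring_unit_mult_left_cancel\<close>)
  also have "eq_upto N \<dots> (\<lambda>t. T t * (defect a * F t * (1 + t *\<^sub>R g k k t)))"
    by (intro eq_upto_mult[OF eq_upto_refl] combined bounded0_intros bounded bounded_g)
  finally show ?thesis
    by (simp add: transmission_left_def T_def a_def mult.assoc)
qed

lemma off_diagonal_at_0_even:
  assumes "even k"
  shows "g k (k - 1) 0 = - adj (\<alpha> (k + 1)) * defect (adj (\<alpha> k))"
  using g_eq[of "k + 1" 0 "k - 1"] q_eq[of k 0 "k - 1"] q_eq[of "k + 2" 0 "k - 1"] assms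
  by (simp add: forced_def add.commute)

lemma off_diagonal_at_0_odd:
  assumes "odd k"
  shows "g (k - 1) k 0 = defect (\<alpha> k) * - adj (\<alpha> (k + 1))"
  using g_eq[of k 0 k] q_eq[of "k + 1" 0 k] q_eq[of "k - 1" 0 k] assms
  by (simp add: forced_def)

end

subsection \<open>Recovering the Verblunsky coefficients\<close>

lemma eq_upto_cancel_one_plus:
  fixes g1 g2 h1 h2 P1 P2 :: "real \<Rightarrow> 'a::{real_normed_algebra_1,banach}"
  assumes h1: "eq_upto N h1 (\<lambda>t. P1 t * (1 + t *\<^sub>R g1 t))"
    and h2: "eq_upto N h2 (\<lambda>t. P2 t * (1 + t *\<^sub>R g2 t))"
    and h: "eq_upto N h1 h2" and g: "eq_upto N g1 g2" and bounded: "bounded0 g1" "bounded0 P2"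
  shows "eq_upto N P1 P2"
proof (rule eq_upto_cancel_right)
  show "eq_upto N (\<lambda>t. P1 t * (1 + t *\<^sub>R g1 t)) (\<lambda>t. P2 t * (1 + t *\<^sub>R g2 t))"
    by (rule eq_upto_trans[OF eq_upto_sym[OF h1] eq_upto_trans[OF h h2]])
  show "eq_upto N (\<lambda>t. 1 + t *\<^sub>R g1 t) (\<lambda>t. 1 + t *\<^sub>R g2 t)"
    by (intro eq_upto_add eq_upto_scale eq_upto_refl g)
  show "unit_near0 (\<lambda>t. 1 + t *\<^sub>R g1 t)"
    by (intro unit_near0_one_plus tendsto_0_scale bounded)
qed fact

locale green_kernel_pair = K1: green_kernel \<alpha>1 g1 q1 + K2: green_kernel \<alpha>2 g2 q2
  for \<alpha>1 \<alpha>2 :: "int \<Rightarrow> 'm::finite cmatrix" and g1 q1 g2 q2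
begin

lemma schur_product_even:
  assumes "even k" "eq_upto N (g1 k k) (g2 k k)" "2 * N + 2 \<le> i" "2 * N + 2 \<le> j"
  shows "eq_upto N (\<lambda>t. schur i \<alpha>1 (k + 1) t * schur_left j \<alpha>1 k t)
    (\<lambda>t. schur i \<alpha>2 (k + 1) t * schur_left j \<alpha>2 k t)"
  by (rule eq_upto_cancel_one_plus[OF K1.diagonal_eq_upto_even[OF assms(1,3,4)]
        K2.diagonal_eq_upto_even[OF assms(1,3,4)] assms(2,2) K1.bounded_g])
     (intro bounded0_intros)

lemma schur_product_odd:
  assumes "odd k" "eq_upto N (g1 k k) (g2 k k)" "2 * N + 2 \<le> i" "2 * N + 2 \<le> j"
  shows "eq_upto N (\<lambda>t. schur_left j \<alpha>1 k t * schur i \<alpha>1 (k + 1) t)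
    (\<lambda>t. schur_left j \<alpha>2 k t * schur i \<alpha>2 (k + 1) t)"
  by (rule eq_upto_cancel_one_plus[OF K1.diagonal_eq_upto_odd[OF assms(1,3,4)]
        K2.diagonal_eq_upto_odd[OF assms(1,3,4)] assms(2,2) K1.bounded_g])
     (intro bounded0_intros)

lemma coefficients_eq_if_schur_eq:
  assumes k: "\<alpha>1 k = \<alpha>2 k" and j: "N < j"
    and right: "eq_upto N (schur j \<alpha>1 (k + 1)) (schur j \<alpha>2 (k + 1))"
    and left: "eq_upto M (schur_left j \<alpha>1 (k - 1)) (schur_left j \<alpha>2 (k - 1))" and M: "M \<le> N"
    and m: "k - int M - 1 \<le> m" "m \<le> k + int N + 1"
  shows "\<alpha>1 m = \<alpha>2 m"
proof -
  consider "m = k" | "k + 1 \<le> m" | "m \<le> k - 1"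
    by linarith
  then show ?thesis
  proof cases
    case 2
    then show ?thesis
      using m by (intro schur_inject[OF K1.contr K2.contr right j]) auto
  next
    case 3
    then show ?thesis
      using m j M by (intro schur_left_inject[OF K1.contr K2.contr left]) auto
  qed (simp add: k)
qed

lemma coefficients_eq_if_factors_eq:
  assumes k: "\<alpha>1 k = \<alpha>2 k" and j: "N < j"
    and right: "eq_upto N (schur j \<alpha>1 (k + 1)) (schur j \<alpha>2 (k + 1))"
    and left: "eq_upto N (\<lambda>t. t *\<^sub>R schur_left j \<alpha>1 (k - 1) t)
      (\<lambda>t. t *\<^sub>R schur_left j \<alpha>2 (k - 1) t)"
    and m: "k - int N \<le> m" "m \<le> k + int N + 1"
  shows "\<alpha>1 m = \<alpha>2 m"
proof (cases N)
  case 0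
  then consider "m = k" | "m = k + 1"
    using m by linarith
  then show ?thesis
    using k schur_inject[OF K1.contr K2.contr right j] by cases auto
next
  case (Suc M)
  with left have "eq_upto M (schur_left j \<alpha>1 (k - 1)) (schur_left j \<alpha>2 (k - 1))"
    by (simp add: eq_upto_Suc_scale)
  then show ?thesis
    by (rule coefficients_eq_if_schur_eq[OF k j right]) (use Suc m in auto)
qed

lemma coefficients_eq_if_green_eq_even:
  assumes k: "even k" and g: "eq_upto N (g1 k k) (g2 k k)"
    and h: "eq_upto N (g1 k (k - 1)) (g2 k (k - 1))" and unit: "ring_unit (g1 k (k - 1) 0)"
    and m: "k - int N \<le> m" "m \<le> k + int N + 1"
  shows "\<alpha>1 m = \<alpha>2 m"
proof -
  define j where "j = 2 * N + 2"
  have j: "2 * N + 2 \<le> j" "2 * N + 2 \<le> Suc j" "N < j"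
    by (simp_all add: j_def)
  let ?F = "\<lambda>\<alpha>. schur j \<alpha> (k + 1)" and ?X = "\<lambda>\<alpha> t. t *\<^sub>R schur_left j \<alpha> (k - 1) t"
    and ?G = "\<lambda>\<alpha>. schur_left (Suc j) \<alpha> k"
  have FG: "eq_upto N (\<lambda>t. ?F \<alpha>1 t * ?G \<alpha>1 t) (\<lambda>t. ?F \<alpha>2 t * ?G \<alpha>2 t)"
    by (rule schur_product_even[OF k g j(1,2)])
  have "eq_upto N (\<lambda>t. g1 k (k - 1) t - t *\<^sub>R (?F \<alpha>1 t * ?G \<alpha>1 t * g1 k (k - 1) t))
      (\<lambda>t. g2 k (k - 1) t - t *\<^sub>R (?F \<alpha>2 t * ?G \<alpha>2 t * g2 k (k - 1) t))"
    by (intro eq_upto_diff eq_upto_scale h eq_upto_mult[OF FG h] bounded0_intros K2.bounded_g)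
  then have FT: "eq_upto N (\<lambda>t. ?F \<alpha>1 t * transmission (\<alpha>1 k) (?X \<alpha>1 t))
      (\<lambda>t. ?F \<alpha>2 t * transmission (\<alpha>2 k) (?X \<alpha>2 t))"
    using eq_upto_trans[OF K1.off_diagonal_eq_upto_even[OF k j(1)]
        eq_upto_trans[OF _ eq_upto_sym[OF K2.off_diagonal_eq_upto_even[OF k j(1)]]]] by blast
  have lim: "(?X \<alpha> \<longlongrightarrow> 0) (at_right 0)" for \<alpha> :: "int \<Rightarrow> 'm cmatrix"
    by (intro tendsto_0_scale bounded0_intros)
  have FT_lim: "((\<lambda>t. ?F \<alpha>1 t * transmission (\<alpha>1 k) (?X \<alpha>1 t)) \<longlongrightarrow> g1 k (k - 1) 0) (at_right 0)"
    unfolding K1.off_diagonal_at_0_even[OF k]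
    by (intro tendsto_mult tendsto_schur tendsto_transmission lim) (simp add: j_def)
  note factors = eq_upto_factors[OF K1.contr K2.contr lim lim bounded0_schur FT FT_lim unit
      FG[unfolded schur_left_Suc]]
  show ?thesis
    by (rule coefficients_eq_if_factors_eq[OF factors(1) j(3) factors(3,2) m])
qed

lemma coefficients_eq_if_green_eq_odd:
  assumes k: "odd k" and g: "eq_upto N (g1 k k) (g2 k k)"
    and h: "eq_upto N (g1 (k - 1) k) (g2 (k - 1) k)" and unit: "ring_unit (g1 (k - 1) k 0)"
    and m: "k - int N \<le> m" "m \<le> k + int N + 1"
  shows "\<alpha>1 m = \<alpha>2 m"
proof -
  define j where "j = 2 * N + 2"
  have j: "2 * N + 2 \<le> j" "2 * N + 2 \<le> Suc j" "N < j"
    by (simp_all add: j_def)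
  let ?F = "\<lambda>\<alpha>. schur j \<alpha> (k + 1)" and ?X = "\<lambda>\<alpha> t. t *\<^sub>R schur_left j \<alpha> (k - 1) t"
  have lim: "(?X \<alpha> \<longlongrightarrow> 0) (at_right 0)" for \<alpha> :: "int \<Rightarrow> 'm cmatrix"
    by (intro tendsto_0_scale bounded0_intros)
  have GF: "eq_upto N (\<lambda>t. schur_left (Suc j) \<alpha>1 k t * ?F \<alpha>1 t)
      (\<lambda>t. schur_left (Suc j) \<alpha>2 k t * ?F \<alpha>2 t)"
    by (rule schur_product_odd[OF k g j(1,2)])
  have TF: "eq_upto N (\<lambda>t. transmission_left (\<alpha>1 k) (?X \<alpha>1 t) * ?F \<alpha>1 t)
      (\<lambda>t. transmission_left (\<alpha>2 k) (?X \<alpha>2 t) * ?F \<alpha>2 t)"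
    by (rule eq_upto_cancel_one_plus[OF K1.off_diagonal_eq_upto_odd[OF k j(1)]
          K2.off_diagonal_eq_upto_odd[OF k j(1)] h g K1.bounded_g])
       (intro bounded0_intros bounded0_if_tendsto[OF tendsto_transmission_left[OF lim]])
  have TF_lim: "((\<lambda>t. transmission_left (\<alpha>1 k) (?X \<alpha>1 t) * ?F \<alpha>1 t) \<longlongrightarrow> g1 (k - 1) k 0) (at_right 0)"
    unfolding K1.off_diagonal_at_0_odd[OF k]
    by (intro tendsto_mult tendsto_schur tendsto_transmission_left lim) (simp add: j_def)
  note factors = eq_upto_factors_left[OF K1.contr K2.contr lim lim bounded0_schur TF TF_lim unit
      GF[unfolded schur_left_Suc]]
  show ?thesis
    by (rule coefficients_eq_if_factors_eq[OF factors(1) j(3) factors(3,2) m])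
qed

lemma coefficients_eq_if_diagonals_eq:
  assumes g: "eq_upto N (g1 k k) (g2 k k)"
    and g': "eq_upto N (g1 (k - 1) (k - 1)) (g2 (k - 1) (k - 1))"
    and eq: "\<alpha>1 k = \<alpha>2 k" and unit: "ring_unit (\<alpha>1 k)"
    and m: "k - int N - 1 \<le> m" "m \<le> k + int N + 1"
  shows "\<alpha>1 m = \<alpha>2 m"
proof -
  define j where "j = 2 * N + 2"
  have j: "2 * N + 2 \<le> j" "2 * N + 2 \<le> Suc j" "N < j"
    by (simp_all add: j_def)
  have unit2: "ring_unit (\<alpha>2 k)"
    using unit eq by simp
  have "eq_upto N (schur j \<alpha>1 (k + 1)) (schur j \<alpha>2 (k + 1))
    \<and> eq_upto N (schur_left j \<alpha>1 (k - 1)) (schur_left j \<alpha>2 (k - 1))"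
  proof (cases "even k")
    case True
    then have "odd (k - 1)"
      by simp
    note products = schur_product_even[OF True g j(1,2), unfolded schur_left_Suc eq]
      schur_product_odd[OF this g' j(2,1), unfolded schur.simps diff_add_cancel eq]
    show ?thesis
      using eq_upto_bootstrap[OF unit2 _ _ _ _ products] by (blast intro: bounded0_intros)
  next
    case False
    then have "even (k - 1)"
      by simp
    note products = schur_product_odd[OF False g j(1,2), unfolded schur_left_Suc eq]
      schur_product_even[OF this g' j(2,1), unfolded schur.simps diff_add_cancel eq]
    show ?thesis
      using eq_upto_bootstrap_left[OF K2.contr unit2 _ _ _ _ products]
      by (blast intro: bounded0_intros)
  qed
  then show ?thesis
    using coefficients_eq_if_schur_eq[OF eq j(3) _ _ order_refl m] by blast
qed

lemma coefficients_eq_if_green_eq: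
  assumes "eq_upto N (g1 k k) (g2 k k)" and "eq_upto N (off_diagonal g1 k) (off_diagonal g2 k)"
    and unit: "ring_unit (off_diagonal g1 k 0) \<or> ring_unit (off_diagonal g2 k 0)"
    and "k - int N \<le> m" "m \<le> k + int N + 1"
  shows "\<alpha>1 m = \<alpha>2 m"
  using unit
proof
  assume "ring_unit (off_diagonal g1 k 0)"
  then show ?thesis
    using assms coefficients_eq_if_green_eq_even coefficients_eq_if_green_eq_odd
    by (cases "even k") (simp_all add: off_diagonal_def)
next
  interpret swapped: green_kernel_pair \<alpha>2 \<alpha>1 g2 q2 g1 q1 ..
  assume "ring_unit (off_diagonal g2 k 0)"
  then have "\<alpha>2 m = \<alpha>1 m"
    using assms(1,2)[THEN eq_upto_sym] assms(4,5)
      swapped.coefficients_eq_if_green_eq_even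
      swapped.coefficients_eq_if_green_eq_odd
    by (cases "even k") (simp_all add: off_diagonal_def)
  then show ?thesis ..
qed

end

subsection \<open>The Hilbert space of square summable sequences\<close>

definition ell2_norm :: "(int \<Rightarrow> complex^'m) \<Rightarrow> real" where
  "ell2_norm f = (SUP A\<in>Collect finite. L2_set (\<lambda>n. norm (f n)) A)"

lemma mem_ell2_iff: "f \<in> ell2 \<longleftrightarrow> bdd_above ((\<lambda>A. L2_set (\<lambda>n. norm (f n)) A) ` Collect finite)"
proof
  assume "f \<in> ell2"
  then have "(\<lambda>n. (norm (f n))\<^sup>2) summable_on UNIV"
    by (simp add: ell2_def)
  then have "L2_set (\<lambda>n. norm (f n)) A \<le> sqrt (\<Sum>\<^sub>\<infinity>n. (norm (f n))\<^sup>2)" if "finite A" for A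
    unfolding L2_set_def by (intro real_sqrt_le_mono finite_sum_le_infsum) (use that in auto)
  then show "bdd_above ((\<lambda>A. L2_set (\<lambda>n. norm (f n)) A) ` Collect finite)"
    by (intro bdd_aboveI2) simp
next
  assume "bdd_above ((\<lambda>A. L2_set (\<lambda>n. norm (f n)) A) ` Collect finite)"
  then obtain C where C: "\<And>A. finite A \<Longrightarrow> L2_set (\<lambda>n. norm (f n)) A \<le> C"
    by (auto simp: bdd_above_def)
  have "(\<lambda>n. (norm (f n))\<^sup>2) summable_on UNIV"
  proof (rule nonneg_bounded_partial_sums_imp_summable_on)
    show "eventually (\<lambda>A. (\<Sum>n\<in>A. (norm (f n))\<^sup>2) \<le> C\<^sup>2) (finite_subsets_at_top UNIV)"
      using C
      by (intro eventually_finite_subsets_at_top_weakI)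
         (auto simp: L2_set_def intro: real_le_rsqrt sqrt_le_D)
  qed simp
  then show "f \<in> ell2"
    by (simp add: ell2_def)
qed

lemma
  assumes "\<And>A. finite A \<Longrightarrow> L2_set (\<lambda>n. norm (f n)) A \<le> C"
  shows ell2I: "f \<in> ell2" and ell2_norm_le: "ell2_norm f \<le> C"
  unfolding mem_ell2_iff ell2_norm_def
  by (auto intro!: bdd_aboveI2 cSUP_least assms)

lemma L2_set_le_ell2_norm: "f \<in> ell2 \<Longrightarrow> finite A \<Longrightarrow> L2_set (\<lambda>n. norm (f n)) A \<le> ell2_norm f"
  unfolding mem_ell2_iff ell2_norm_def by (rule cSUP_upper) simp_all

lemma norm_le_ell2_norm: "f \<in> ell2 \<Longrightarrow> norm (f n) \<le> ell2_norm f"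
  using L2_set_le_ell2_norm[of f "{n}"] by simp

lemma ell2_norm_nonneg: "f \<in> ell2 \<Longrightarrow> 0 \<le> ell2_norm f"
  using norm_le_ell2_norm order_trans norm_ge_zero by blast

lemma
  assumes "f \<in> ell2" "g \<in> ell2"
  shows ell2_add: "(\<lambda>n. f n + g n) \<in> ell2"
    and ell2_norm_add_le: "ell2_norm (\<lambda>n. f n + g n) \<le> ell2_norm f + ell2_norm g"
proof -
  have bound: "L2_set (\<lambda>n. norm (f n + g n)) A \<le> ell2_norm f + ell2_norm g" if "finite A" for A
  proof -
    have "L2_set (\<lambda>n. norm (f n + g n)) A \<le> L2_set (\<lambda>n. norm (f n) + norm (g n)) A"
      by (intro L2_set_mono norm_triangle_ineq) simp
    also have "\<dots> \<le> L2_set (\<lambda>n. norm (f n)) A + L2_set (\<lambda>n. norm (g n)) A"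
      by (rule L2_set_triangle_ineq)
    finally show ?thesis
      using L2_set_le_ell2_norm[OF assms(1) that] L2_set_le_ell2_norm[OF assms(2) that] by linarith
  qed
  show "(\<lambda>n. f n + g n) \<in> ell2"
    by (rule ell2I[OF bound])
  show "ell2_norm (\<lambda>n. f n + g n) \<le> ell2_norm f + ell2_norm g"
    by (rule ell2_norm_le[OF bound])
qed

lemma norm_vector_smult: "norm (c *s x) = norm c * norm x" for x :: "complex^'m"
  by (simp add: norm_vec_def norm_mult L2_set_right_distrib)

lemma bounded_linear_vector_smult: "bounded_linear ((*s) c)" for c :: complex
  by (rule bounded_linear_intro[where K = "norm c"])
     (simp_all add: vector_add_ldistrib vec_eq_iff norm_vector_smult mult.commute)

lemma
  assumes "f \<in> ell2"
  shows ell2_smult: "(\<lambda>n. c *s f n) \<in> ell2"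
    and ell2_norm_smult_le: "ell2_norm (\<lambda>n. c *s f n) \<le> norm c * ell2_norm f"
proof -
  have bound: "L2_set (\<lambda>n. norm (c *s f n)) A \<le> norm c * ell2_norm f" if "finite A" for A
    using L2_set_le_ell2_norm[OF assms that]
    by (simp add: norm_vector_smult mult_left_mono flip: L2_set_right_distrib)
  show "(\<lambda>n. c *s f n) \<in> ell2"
    by (rule ell2I[OF bound])
  show "ell2_norm (\<lambda>n. c *s f n) \<le> norm c * ell2_norm f"
    by (rule ell2_norm_le[OF bound])
qed

lemma
  shows unit_seq_ell2: "unit_seq k i \<in> ell2"
    and ell2_norm_unit_seq_le: "ell2_norm (unit_seq k i) \<le> 1"
proof -
  have bound: "L2_set (\<lambda>n. norm (unit_seq k i n)) A \<le> 1" if "finite A" for A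
  proof -
    have "(\<Sum>n\<in>A. (norm (unit_seq k i n))\<^sup>2) = (\<Sum>n\<in>A. if n = k then 1 else 0)"
      by (intro sum.cong) (auto simp: unit_seq_def)
    then show ?thesis
      using that by (simp add: L2_set_def)
  qed
  show "unit_seq k i \<in> ell2"
    by (rule ell2I[OF bound])
  show "ell2_norm (unit_seq k i) \<le> 1"
    by (rule ell2_norm_le[OF bound])
qed

lemma
  fixes x :: "nat \<Rightarrow> int \<Rightarrow> complex^'m"
  assumes x: "\<And>j. x j \<in> ell2" and norms: "summable (\<lambda>j. ell2_norm (x j))"
  shows summable_ell2_nth: "summable (\<lambda>j. x j n)"
    and ell2_suminf: "(\<lambda>n. \<Sum>j. x j n) \<in> ell2"
proof -
  show summable: "summable (\<lambda>j. x j n)" for n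
    using norm_le_ell2_norm[OF x] by (intro summable_comparison_test'[OF norms])
  show "(\<lambda>n. \<Sum>j. x j n) \<in> ell2"
  proof (rule ell2I)
    fix A :: "int set"
    assume A: "finite A"
    have partial: "(\<lambda>n. \<Sum>i<j. x i n) \<in> ell2
        \<and> ell2_norm (\<lambda>n. \<Sum>i<j. x i n) \<le> (\<Sum>i<j. ell2_norm (x i))" for j
    proof (induction j)
      case 0
      show ?case
        using ell2I[of "\<lambda>_. 0" 0] ell2_norm_le[of "\<lambda>_. 0" 0] by (simp add: L2_set_def)
    next
      case (Suc j)
      then show ?case
        using ell2_add[OF _ x[of j]] ell2_norm_add_le[OF _ x[of j]] by (force simp: add.commute)
    qed
    have "L2_set (\<lambda>n. norm (\<Sum>i<j. x i n)) A \<le> (\<Sum>j. ell2_norm (x j))" for j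
    proof -
      have "L2_set (\<lambda>n. norm (\<Sum>i<j. x i n)) A \<le> ell2_norm (\<lambda>n. \<Sum>i<j. x i n)"
        using partial[of j] A by (intro L2_set_le_ell2_norm) simp_all
      also have "\<dots> \<le> (\<Sum>j. ell2_norm (x j))"
        using partial[of j] sum_le_suminf[OF norms, of "{..<j}"] ell2_norm_nonneg[OF x] by fastforce
      finally show ?thesis .
    qed
    moreover have "(\<lambda>j. L2_set (\<lambda>n. norm (\<Sum>i<j. x i n)) A)
        \<longlonglongrightarrow> L2_set (\<lambda>n. norm (\<Sum>j. x j n)) A"
      unfolding L2_set_def by (intro tendsto_intros summable_LIMSEQ summable)
    ultimately show "L2_set (\<lambda>n. norm (\<Sum>j. x j n)) A \<le> (\<Sum>j. ell2_norm (x j))"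
      by (intro LIMSEQ_le_const2) auto
  qed
qed

subsection \<open>The CMV operator\<close>

lemma rho_tilde_eq: "rho_tilde a = rho (adj_mat a)"
  by (simp add: rho_tilde_def rho_def)

lemma of_mat_simps:
  "of_mat (rho a) = defect (of_mat a)" "of_mat (rho_tilde a) = defect (adj (of_mat a))"
  "of_mat (adj_mat a) = adj (of_mat a)" "norm (of_mat a) = op_norm a"
  "of_mat (a + b) = of_mat a + of_mat b" "of_mat (a - b) = of_mat a - of_mat b"
  "of_mat (- a) = - of_mat a" "of_mat (a ** b) = of_mat a * of_mat b" "of_mat (mat 1) = 1"
  by (simp_all add: rho_tilde_eq defect.abs_eq adj.abs_eq norm_cmatrix.abs_eq plus_cmatrix.abs_eq
      minus_cmatrix.abs_eq uminus_cmatrix.abs_eq times_cmatrix.abs_eq one_cmatrix.abs_eq)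

lemma
  fixes a :: "complex^'m^'m"
  assumes "op_norm a < 1"
  shows rho_square: "rho a ** rho a = mat 1 - adj_mat a ** a"
    and rho_intertwines: "a ** rho a = rho (adj_mat a) ** a"
    and adj_mat_rho: "adj_mat (rho a) = rho a"
proof -
  have of_mat_eqI: "of_mat A = of_mat B \<Longrightarrow> A = B" for A B :: "complex^'m^'m"
    by (simp add: of_mat_inject)
  show "rho a ** rho a = mat 1 - adj_mat a ** a" "a ** rho a = rho (adj_mat a) ** a"
    "adj_mat (rho a) = rho a"
    by (rule of_mat_eqI, simp add: of_mat_simps defect_square defect_intertwines adj_defect assms)+
qed

lemma op_norm_adj_mat [simp]: "op_norm (adj_mat a) = op_norm a"
  by (metis norm_adj of_mat_simps(3,4))

text \<open>\<open>V\<close> and \<open>W\<close> are the cases \<open>p = True\<close> and \<open>p = False\<close> of one operator.\<close>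

definition block_op :: "bool \<Rightarrow> (int \<Rightarrow> complex^'m^'m) \<Rightarrow> (int \<Rightarrow> complex^'m) \<Rightarrow> int \<Rightarrow> complex^'m" where
  "block_op p \<alpha> f n =
     (if even n = p then rho (\<alpha> n) *v f (n - 1) + adj_mat (\<alpha> n) *v f n
      else - \<alpha> (n + 1) *v f n + rho (adj_mat (\<alpha> (n + 1))) *v f (n + 1))"

lemma uminus_matrix_vector: "(- A) *v x = - (A *v x)" for A :: "complex^'m^'m"
  using matrix_vector_mult_diff_rdistrib[of 0 A x] by simp

lemma cmv_U_eq: "cmv_U \<alpha> f = block_op True \<alpha> (block_op False \<alpha> f)"
  by (auto simp: fun_eq_iff cmv_U_def cmv_V_def cmv_W_def block_op_def Theta_def rho_tilde_eq)

lemma block_op_block: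
  assumes "even m = p"
  shows "block_op p \<alpha> f m = rho (\<alpha> m) *v f (m - 1) + adj_mat (\<alpha> m) *v f m"
    and "block_op p \<alpha> f (m - 1) = - \<alpha> m *v f (m - 1) + rho (adj_mat (\<alpha> m)) *v f m"
  using assms by (auto simp: block_op_def)

lemma block_cases:
  obtains m :: int where "even m = p" and "n = m \<or> n = m - 1"
  using that[of n] that[of "n + 1"] by fastforce

lemma finite_subset_of_blocks:
  fixes A :: "int set"
  assumes "finite A"
  obtains M where "finite M" and "\<And>m. m \<in> M \<Longrightarrow> even m = p" and "A \<subseteq> M \<union> (\<lambda>m. m - 1) ` M"
proof (rule that)
  define M where "M = {m \<in> A \<union> (\<lambda>n. n + 1) ` A. even m = p}"
  show "finite M"
    using assms by (simp add: M_def)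
  show "even m = p" if "m \<in> M" for m
    using that by (simp add: M_def)
  show "A \<subseteq> M \<union> (\<lambda>m. m - 1) ` M"
  proof
    fix n
    assume n: "n \<in> A"
    obtain m where "even m = p" "n = m \<or> n = m - 1"
      by (rule block_cases[of p n])
    with n have "m \<in> M"
      by (auto simp: M_def intro: rev_image_eqI)
    with \<open>n = m \<or> n = m - 1\<close> show "n \<in> M \<union> (\<lambda>m. m - 1) ` M"
      by blast
  qed
qed

lemma sum_over_blocks:
  fixes h :: "int \<Rightarrow> 'a::comm_monoid_add"
  assumes "finite M" and "\<And>m. m \<in> M \<Longrightarrow> even m = p"
  shows "(\<Sum>n\<in>M \<union> (\<lambda>m. m - 1) ` M. h n) = (\<Sum>m\<in>M. h m + h (m - 1))"
proof -
  have "m - 1 \<notin> M" if "m \<in> M" for m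
    using assms(2)[OF that] assms(2)[of "m - 1"] by auto
  then have "M \<inter> (\<lambda>m. m - 1) ` M = {}"
    by auto
  then show ?thesis
    using assms(1) by (simp add: sum.union_disjoint sum.reindex inj_on_def sum.distrib)
qed

lemma block_op_smult: "block_op p \<alpha> (\<lambda>n. c *s f n) = (\<lambda>n. c *s block_op p \<alpha> f n)"
  by (auto simp: block_op_def fun_eq_iff vector_scalar_commute vector_add_ldistrib)

lemma block_op_add: "block_op p \<alpha> (\<lambda>n. f n + h n) = (\<lambda>n. block_op p \<alpha> f n + block_op p \<alpha> h n)"
  by (auto simp: block_op_def fun_eq_iff matrix_vector_right_distrib)

lemma block_op_sums:
  assumes "\<And>n. (\<lambda>j. x j n) sums f n"
  shows "(\<lambda>j. block_op p \<alpha> (x j) n) sums block_op p \<alpha> f n"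
proof -
  note sums = bounded_linear.sums[OF matrix_vector_mul_bounded_linear assms]
  show ?thesis
    unfolding block_op_def by (cases "even n = p") (simp_all add: sums_add[OF sums sums])
qed

context
  fixes \<alpha> :: "int \<Rightarrow> complex^'m^'m"
  assumes contr: "\<And>n. op_norm (\<alpha> n) < 1"
begin

lemma defect_relations:
  shows "rho (\<alpha> m) ** rho (\<alpha> m) = mat 1 - adj_mat (\<alpha> m) ** \<alpha> m"
    and "rho (adj_mat (\<alpha> m)) ** rho (adj_mat (\<alpha> m)) = mat 1 - \<alpha> m ** adj_mat (\<alpha> m)"
    and "rho (\<alpha> m) ** adj_mat (\<alpha> m) = adj_mat (\<alpha> m) ** rho (adj_mat (\<alpha> m))"
    and "rho (adj_mat (\<alpha> m)) ** \<alpha> m = \<alpha> m ** rho (\<alpha> m)"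
  using rho_square[of "\<alpha> m"] rho_square[of "adj_mat (\<alpha> m)"] rho_intertwines[of "\<alpha> m"]
    rho_intertwines[of "adj_mat (\<alpha> m)"] by (simp_all add: contr)

lemma block_op_adj: "block_op p \<alpha> (block_op p (\<lambda>n. adj_mat (\<alpha> n)) f) = f"
proof
  fix n :: int
  obtain m where m: "even m = p" "n = m \<or> n = m - 1"
    by (rule block_cases[of p n])
  have "block_op p \<alpha> (block_op p (\<lambda>n. adj_mat (\<alpha> n)) f) m = f m"
    "block_op p \<alpha> (block_op p (\<lambda>n. adj_mat (\<alpha> n)) f) (m - 1) = f (m - 1)"
    unfolding block_op_block[OF m(1)] uminus_matrix_vector
    by (simp_all add: matrix_vector_right_distrib matrix_vector_mult_diff_distrib vec.neg
        matrix_vector_mult_diff_rdistrib matrix_vector_mul_assoc defect_relations)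
  then show "block_op p \<alpha> (block_op p (\<lambda>n. adj_mat (\<alpha> n)) f) n = f n"
    using m(2) by auto
qed

lemma block_op_isometric:
  assumes m: "even m = p"
  shows "(norm (block_op p \<alpha> f m))\<^sup>2 + (norm (block_op p \<alpha> f (m - 1)))\<^sup>2
    = (norm (f m))\<^sup>2 + (norm (f (m - 1)))\<^sup>2"
proof -
  define a r s where "a = \<alpha> m" and "r = rho a" and "s = rho (adj_mat a)"
  define x y where "x = f (m - 1)" and "y = f m"
  note relations = defect_relations[of m, folded a_def, folded r_def s_def]
  have adjoint: "adj_mat r = r" "adj_mat s = s"
    using contr[of m] by (simp_all add: r_def s_def a_def adj_mat_rho)
  have inner_matrix: "(A *v u) \<bullet> (B *v w) = u \<bullet> ((adj_mat A ** B) *v w)"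
    for A B :: "complex^'m^'m" and u w
    using inner_adj_mat[of "adj_mat A" u "B *v w"] by (simp add: matrix_vector_mul_assoc)
  have norm_sum: "(norm (u + w))\<^sup>2 = u \<bullet> u + 2 * (u \<bullet> w) + w \<bullet> w" for u w :: "complex^'m"
    by (simp add: power2_norm_eq_inner inner_add_left inner_add_right inner_commute)
  have "(norm (r *v x + adj_mat a *v y))\<^sup>2 + (norm (- a *v x + s *v y))\<^sup>2
      = x \<bullet> ((r ** r + adj_mat a ** a) *v x) + y \<bullet> ((a ** adj_mat a + s ** s) *v y)
        + 2 * (x \<bullet> ((r ** adj_mat a - adj_mat a ** s) *v y))"
    unfolding norm_sum uminus_matrix_vector
    by (simp add: inner_matrix adjoint inner_add_right inner_diff_right
        matrix_vector_mult_add_rdistrib matrix_vector_mult_diff_rdistrib)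
  also have "\<dots> = (norm x)\<^sup>2 + (norm y)\<^sup>2"
    by (simp add: relations power2_norm_eq_inner)
  finally show ?thesis
    by (simp add: block_op_block[OF m] a_def r_def s_def x_def y_def)
qed

lemma
  assumes f: "f \<in> ell2"
  shows block_op_ell2: "block_op p \<alpha> f \<in> ell2"
    and ell2_norm_block_op_le: "ell2_norm (block_op p \<alpha> f) \<le> ell2_norm f"
proof -
  have bound: "L2_set (\<lambda>n. norm (block_op p \<alpha> f n)) A \<le> ell2_norm f" if A: "finite A" for A
  proof -
    obtain M where M: "finite M" "\<And>m. m \<in> M \<Longrightarrow> even m = p" "A \<subseteq> M \<union> (\<lambda>m. m - 1) ` M"
      by (rule finite_subset_of_blocks[OF A, of p]) blast
    let ?B = "M \<union> (\<lambda>m. m - 1) ` M"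
    have "(\<Sum>n\<in>A. (norm (block_op p \<alpha> f n))\<^sup>2) \<le> (\<Sum>n\<in>?B. (norm (block_op p \<alpha> f n))\<^sup>2)"
      using M(1,3) by (intro sum_mono2) simp_all
    also have "\<dots> = (\<Sum>m\<in>M. (norm (block_op p \<alpha> f m))\<^sup>2 + (norm (block_op p \<alpha> f (m - 1)))\<^sup>2)"
      by (rule sum_over_blocks[OF M(1,2)])
    also have "\<dots> = (\<Sum>m\<in>M. (norm (f m))\<^sup>2 + (norm (f (m - 1)))\<^sup>2)"
      by (intro sum.cong block_op_isometric M(2)) simp_all
    also have "\<dots> = (\<Sum>n\<in>?B. (norm (f n))\<^sup>2)"
      by (rule sum_over_blocks[OF M(1,2), symmetric])
    finally have "L2_set (\<lambda>n. norm (block_op p \<alpha> f n)) A \<le> L2_set (\<lambda>n. norm (f n)) ?B"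
      by (simp add: L2_set_def)
    also have "\<dots> \<le> ell2_norm f"
      using M(1) by (intro L2_set_le_ell2_norm f) simp
    finally show ?thesis .
  qed
  show "block_op p \<alpha> f \<in> ell2"
    by (rule ell2I[OF bound])
  show "ell2_norm (block_op p \<alpha> f) \<le> ell2_norm f"
    by (rule ell2_norm_le[OF bound])
qed

end

definition cmv_inv :: "(int \<Rightarrow> complex^'m^'m) \<Rightarrow> (int \<Rightarrow> complex^'m) \<Rightarrow> int \<Rightarrow> complex^'m" where
  "cmv_inv \<alpha> f = block_op False (\<lambda>n. adj_mat (\<alpha> n)) (block_op True (\<lambda>n. adj_mat (\<alpha> n)) f)"

lemma cmv_inv_affine: "cmv_inv \<alpha> (\<lambda>n. z *s f n + h n) = (\<lambda>n. z *s cmv_inv \<alpha> f n + cmv_inv \<alpha> h n)"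
  by (simp add: cmv_inv_def block_op_add block_op_smult)

lemma cmv_inv_sums:
  "(\<And>n. (\<lambda>j. x j n) sums f n) \<Longrightarrow> (\<lambda>j. cmv_inv \<alpha> (x j) n) sums cmv_inv \<alpha> f n"
  unfolding cmv_inv_def by (intro block_op_sums)

primrec neumann_term ::
    "(int \<Rightarrow> complex^'m^'m) \<Rightarrow> complex \<Rightarrow> (int \<Rightarrow> complex^'m) \<Rightarrow> nat \<Rightarrow> int \<Rightarrow> complex^'m" where
  "neumann_term \<alpha> z \<delta> 0 = cmv_inv \<alpha> \<delta>"
| "neumann_term \<alpha> z \<delta> (Suc j) = (\<lambda>n. z *s cmv_inv \<alpha> (neumann_term \<alpha> z \<delta> j) n)"

context
  fixes \<alpha> :: "int \<Rightarrow> complex^'m^'m"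
  assumes contr: "\<And>n. op_norm (\<alpha> n) < 1"
begin

lemma cmv_U_cmv_inv: "cmv_U \<alpha> (cmv_inv \<alpha> f) = f"
  by (simp add: cmv_U_eq cmv_inv_def block_op_adj contr)

lemma block_op_adj_left: "block_op p (\<lambda>n. adj_mat (\<alpha> n)) (block_op p \<alpha> f) = f"
  using block_op_adj[of "\<lambda>n. adj_mat (\<alpha> n)" p f] by (simp add: contr)

lemma
  assumes "f \<in> ell2"
  shows cmv_inv_ell2: "cmv_inv \<alpha> f \<in> ell2"
    and ell2_norm_cmv_inv_le: "ell2_norm (cmv_inv \<alpha> f) \<le> ell2_norm f"
proof -
  have adj_contr: "op_norm (adj_mat (\<alpha> n)) < 1" for n
    by (simp add: contr)
  note bounds = block_op_ell2[OF adj_contr] ell2_norm_block_op_le[OF adj_contr]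
  show "cmv_inv \<alpha> f \<in> ell2"
    unfolding cmv_inv_def by (intro bounds assms)
  show "ell2_norm (cmv_inv \<alpha> f) \<le> ell2_norm f"
    unfolding cmv_inv_def by (rule order_trans[OF bounds(2) bounds(2)]) (intro bounds assms)+
qed

lemma
  assumes \<delta>: "\<delta> \<in> ell2"
  shows neumann_term_ell2: "neumann_term \<alpha> z \<delta> j \<in> ell2"
    and ell2_norm_neumann_term_le: "ell2_norm (neumann_term \<alpha> z \<delta> j) \<le> norm z ^ j * ell2_norm \<delta>"
proof -
  have "neumann_term \<alpha> z \<delta> j \<in> ell2
    \<and> ell2_norm (neumann_term \<alpha> z \<delta> j) \<le> norm z ^ j * ell2_norm \<delta>"
  proof (induction j)
    case 0
    then show ?case
      by (simp add: cmv_inv_ell2 ell2_norm_cmv_inv_le \<delta>)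
  next
    case (Suc j)
    let ?x = "neumann_term \<alpha> z \<delta>"
    have "ell2_norm (?x (Suc j)) \<le> norm z * ell2_norm (cmv_inv \<alpha> (?x j))"
      using Suc by (simp add: ell2_norm_smult_le cmv_inv_ell2)
    also have "\<dots> \<le> norm z * (norm z ^ j * ell2_norm \<delta>)"
      using Suc by (intro mult_left_mono order_trans[OF ell2_norm_cmv_inv_le]) simp_all
    finally show ?case
      using Suc by (simp add: ell2_smult cmv_inv_ell2 mult.assoc)
  qed
  then show "neumann_term \<alpha> z \<delta> j \<in> ell2"
    "ell2_norm (neumann_term \<alpha> z \<delta> j) \<le> norm z ^ j * ell2_norm \<delta>"
    by simp_all
qed

lemma cmv_resolvent_equation_solvable:
  assumes z: "norm z < 1" and \<delta>: "\<delta> \<in> ell2"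
  obtains f where "f \<in> ell2" and "cmv_U \<alpha> f = (\<lambda>n. z *s f n + \<delta> n)"
proof -
  let ?x = "neumann_term \<alpha> z \<delta>"
  have "summable (\<lambda>j. norm z ^ j * ell2_norm \<delta>)"
    using z by (intro summable_mult2 summable_geometric) simp
  moreover have "norm (ell2_norm (?x j)) \<le> norm z ^ j * ell2_norm \<delta>" for j
    using ell2_norm_neumann_term_le[OF \<delta>] ell2_norm_nonneg[OF neumann_term_ell2[OF \<delta>]] by simp
  ultimately have norms: "summable (\<lambda>j. ell2_norm (?x j))"
    by (rule summable_comparison_test')
  define f where "f n = (\<Sum>j. ?x j n)" for n
  have f: "f \<in> ell2" "\<And>n. (\<lambda>j. ?x j n) sums f n"
    unfolding f_def[abs_def]
    by (intro ell2_suminf summable_sums summable_ell2_nth neumann_term_ell2 \<delta> norms)+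
  have "f = cmv_inv \<alpha> (\<lambda>n. z *s f n + \<delta> n)"
  proof
    fix n
    have "(\<lambda>j. z *s cmv_inv \<alpha> (?x j) n) sums (z *s cmv_inv \<alpha> f n)"
      by (intro bounded_linear.sums[OF bounded_linear_vector_smult] cmv_inv_sums f(2))
    then have "(\<lambda>j. ?x j n) sums (z *s cmv_inv \<alpha> f n + ?x 0 n)"
      using sums_Suc_iff[of "\<lambda>j. ?x j n"] by simp
    then show "f n = cmv_inv \<alpha> (\<lambda>n. z *s f n + \<delta> n) n"
      using sums_unique2[OF f(2)] by (simp add: cmv_inv_affine)
  qed
  then have "cmv_U \<alpha> f = (\<lambda>n. z *s f n + \<delta> n)"
    using cmv_U_cmv_inv by metis
  with f(1) show thesis ..
qed

lemma
  assumes z: "norm z < 1" and \<delta>: "\<delta> \<in> ell2"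
  shows cmv_resolvent_ell2: "cmv_resolvent \<alpha> z \<delta> \<in> ell2"
    and cmv_U_cmv_resolvent:
      "cmv_U \<alpha> (cmv_resolvent \<alpha> z \<delta>) = (\<lambda>n. z *s cmv_resolvent \<alpha> z \<delta> n + \<delta> n)"
proof -
  obtain f where "f \<in> ell2" "cmv_U \<alpha> f = (\<lambda>n. z *s f n + \<delta> n)"
    using cmv_resolvent_equation_solvable[OF z \<delta>] .
  then have in_image: "\<delta> \<in> (\<lambda>f n. cmv_U \<alpha> f n - z *s f n) ` ell2"
    by (intro image_eqI[of _ _ f]) (simp_all add: fun_eq_iff)
  show "cmv_resolvent \<alpha> z \<delta> \<in> ell2"
    unfolding cmv_resolvent_def by (rule inv_into_into[OF in_image])
  have "(\<lambda>n. cmv_U \<alpha> (cmv_resolvent \<alpha> z \<delta>) n - z *s cmv_resolvent \<alpha> z \<delta> n) = \<delta>"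
    unfolding cmv_resolvent_def by (rule f_inv_into_f[OF in_image])
  then show "cmv_U \<alpha> (cmv_resolvent \<alpha> z \<delta>) = (\<lambda>n. z *s cmv_resolvent \<alpha> z \<delta> n + \<delta> n)"
    by (auto simp: fun_eq_iff algebra_simps)
qed

lemma ell2_norm_cmv_resolvent_le:
  assumes z: "norm z < 1" and \<delta>: "\<delta> \<in> ell2"
  shows "ell2_norm (cmv_resolvent \<alpha> z \<delta>) \<le> ell2_norm \<delta> / (1 - norm z)"
proof -
  define f where "f = cmv_resolvent \<alpha> z \<delta>"
  have f: "f \<in> ell2" "cmv_U \<alpha> f = (\<lambda>n. z *s f n + \<delta> n)"
    by (simp_all add: f_def cmv_resolvent_ell2[OF z \<delta>] cmv_U_cmv_resolvent[OF z \<delta>])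
  have "f = cmv_inv \<alpha> (cmv_U \<alpha> f)"
    by (simp add: cmv_inv_def cmv_U_eq block_op_adj_left)
  then have "ell2_norm f \<le> ell2_norm (\<lambda>n. z *s f n + \<delta> n)"
    unfolding f(2) using ell2_norm_cmv_inv_le[OF ell2_add[OF ell2_smult[OF f(1)] \<delta>]] by metis
  also have "\<dots> \<le> norm z * ell2_norm f + ell2_norm \<delta>"
    using ell2_norm_add_le[OF ell2_smult[OF f(1)] \<delta>] ell2_norm_smult_le[OF f(1)]
    by (meson add_right_mono order_trans)
  finally show ?thesis
    using z by (simp add: f_def field_simps)
qed

end

subsection \<open>Green's matrices of CMV operators\<close>

definition of_columns :: "('m \<Rightarrow> complex^'m) \<Rightarrow> 'm::finite cmatrix" where
  "of_columns x = of_mat (\<chi> i j. x j $ i)"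

lemma of_columns_add: "of_columns (\<lambda>j. x j + y j) = of_columns x + of_columns y"
  by (simp add: of_columns_def plus_cmatrix.abs_eq vec_eq_iff of_mat_inject)

lemma of_columns_scaleR: "of_columns (\<lambda>j. complex_of_real c *s x j) = c *\<^sub>R of_columns x"
  by (simp add: of_columns_def scaleR_cmatrix.abs_eq vec_eq_iff of_mat_inject
      scaleR_conv_of_real[where 'a = complex])

lemma of_columns_matrix_vector: "of_columns (\<lambda>j. A *v x j) = of_mat A * of_columns x"
  by (simp add: of_columns_def times_cmatrix.abs_eq vec_eq_iff of_mat_inject matrix_vector_mult_def
      matrix_matrix_mult_def)

lemma of_columns_unit_seq: "of_columns (\<lambda>j. unit_seq k j n) = (if n = k then 1 else 0)"
  by (auto simp: of_columns_def one_cmatrix.abs_eq zero_cmatrix.abs_eq vec_eq_iff of_mat_inject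
      unit_seq_def axis_def mat_def)

lemma norm_of_columns_le: "norm (of_columns x) \<le> (\<Sum>j\<in>UNIV. norm (x j))"
  using op_norm_le_sum_columns[of "\<chi> i j. x j $ i"]
  by (simp add: of_columns_def of_mat_simps column_def)

lemma of_columns_block_op:
  assumes "even m = p"
  shows "(of_columns (\<lambda>j. block_op p \<alpha> (f j) (m - 1)), of_columns (\<lambda>j. block_op p \<alpha> (f j) m))
    = theta_mult (of_mat (\<alpha> m)) (of_columns (\<lambda>j. f j (m - 1)), of_columns (\<lambda>j. f j m))"
  by (simp add: block_op_block[OF assms] of_columns_add of_columns_matrix_vector of_mat_simps)

definition green_entry :: "(int \<Rightarrow> complex^'m^'m) \<Rightarrow> int \<Rightarrow> int \<Rightarrow> real \<Rightarrow> 'm cmatrix" where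
  "green_entry \<alpha> n k t = of_columns (\<lambda>j. cmv_resolvent \<alpha> (complex_of_real t) (unit_seq k j) n)"

definition W_green_entry :: "(int \<Rightarrow> complex^'m^'m) \<Rightarrow> int \<Rightarrow> int \<Rightarrow> real \<Rightarrow> 'm cmatrix" where
  "W_green_entry \<alpha> n k t =
    of_columns (\<lambda>j. block_op False \<alpha> (cmv_resolvent \<alpha> (complex_of_real t) (unit_seq k j)) n)"

lemma of_mat_g_fun: "of_mat (g_fun \<alpha> (complex_of_real t) k) = green_entry \<alpha> k k t"
  by (simp add: g_fun_def green_def green_entry_def of_columns_def)

lemma of_mat_h_fun: "of_mat (h_fun \<alpha> (complex_of_real t) k) = off_diagonal (green_entry \<alpha>) k t"
  by (simp add: h_fun_def off_diagonal_def green_def green_entry_def of_columns_def)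

lemma invertible_h_fun_iff:
  "invertible (h_fun \<alpha> 0 k) \<longleftrightarrow> ring_unit (off_diagonal (green_entry \<alpha>) k 0)"
  using of_mat_h_fun[of \<alpha> 0 k] by (simp add: ring_unit_of_mat_iff[symmetric])

lemma bounded0_of_columns:
  assumes "\<And>t j. 0 < t \<Longrightarrow> t < 1 \<Longrightarrow> norm (x t j) \<le> 1 / (1 - t)"
  shows "bounded0 (\<lambda>t. of_columns (x t :: 'm::finite \<Rightarrow> complex^'m))"
proof (rule bounded0_dominated)
  show "eventually (\<lambda>t. norm (of_columns (x t)) \<le> (\<Sum>j\<in>(UNIV :: 'm set). 1 / (1 - t))) (at_right 0)"
    using eventually_at_right_0_1
    by eventually_elim (rule order_trans[OF norm_of_columns_le sum_mono[OF assms]]; simp)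
  show "(\<lambda>t::real. \<Sum>j\<in>(UNIV :: 'm set). 1 / (1 - t)) \<in> O[at_right 0](\<lambda>_. 1)"
    by (rule bigoI_tendsto[of _ _ "of_nat CARD('m)"]) (auto intro!: tendsto_eq_intros)
qed

context
  fixes \<alpha> :: "int \<Rightarrow> complex^'m^'m"
  assumes contr: "\<And>n. op_norm (\<alpha> n) < 1"
begin

lemma
  fixes k :: int and j :: 'm and t :: real
  assumes "0 \<le> t" "t < 1"
  defines "f \<equiv> cmv_resolvent \<alpha> (complex_of_real t) (unit_seq k j)"
  shows norm_green_column_le: "norm (f n) \<le> 1 / (1 - t)"
    and norm_W_green_column_le: "norm (block_op False \<alpha> f n) \<le> 1 / (1 - t)"
proof -
  have z: "norm (complex_of_real t) < 1"
    using assms by simp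
  have f: "f \<in> ell2"
    unfolding f_def by (rule cmv_resolvent_ell2[OF contr z unit_seq_ell2])
  have "ell2_norm f \<le> ell2_norm (unit_seq k j) / (1 - norm (complex_of_real t))"
    unfolding f_def by (rule ell2_norm_cmv_resolvent_le[OF contr z unit_seq_ell2])
  also have "\<dots> \<le> 1 / (1 - t)"
    using assms by (simp add: divide_right_mono ell2_norm_unit_seq_le)
  finally have bound: "ell2_norm f \<le> 1 / (1 - t)" .
  show "norm (f n) \<le> 1 / (1 - t)"
    by (rule order_trans[OF norm_le_ell2_norm[OF f] bound])
  have "norm (block_op False \<alpha> f n) \<le> ell2_norm (block_op False \<alpha> f)"
    by (intro norm_le_ell2_norm block_op_ell2 contr f)
  also have "\<dots> \<le> ell2_norm f"
    by (intro ell2_norm_block_op_le contr f)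
  finally show "norm (block_op False \<alpha> f n) \<le> 1 / (1 - t)"
    using bound by simp
qed

lemma W_green_column_eq:
  fixes k :: int and j :: 'm and t :: real
  assumes "0 \<le> t" "t < 1"
  defines "f \<equiv> cmv_resolvent \<alpha> (complex_of_real t) (unit_seq k j)"
  shows "block_op False \<alpha> f
    = block_op True (\<lambda>n. adj_mat (\<alpha> n)) (\<lambda>n. complex_of_real t *s f n + unit_seq k j n)"
proof -
  have "block_op True \<alpha> (block_op False \<alpha> f) = (\<lambda>n. complex_of_real t *s f n + unit_seq k j n)"
    using cmv_U_cmv_resolvent[OF contr, of "complex_of_real t" "unit_seq k j"] assms(1,2)
    by (simp add: f_def cmv_U_eq unit_seq_ell2)
  then show ?thesis
    using block_op_adj_left[where \<alpha> = \<alpha> and p = True and f = "block_op False \<alpha> f", OF contr] by simp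
qed

lemma green_kernel_green_entry:
  "green_kernel (\<lambda>n. of_mat (\<alpha> n)) (green_entry \<alpha>) (W_green_entry \<alpha>)"
proof
  fix n k :: int and t :: real
  let ?f = "\<lambda>t j. cmv_resolvent \<alpha> (complex_of_real t) (unit_seq k j)"
  let ?\<alpha>' = "\<lambda>n. adj_mat (\<alpha> n)"
  show "norm (of_mat (\<alpha> n)) < 1"
    by (simp add: of_mat_simps contr)
  show "bounded0 (green_entry \<alpha> n k)"
    unfolding green_entry_def[abs_def]
    by (rule bounded0_of_columns) (simp add: norm_green_column_le)
  show "bounded0 (W_green_entry \<alpha> n k)"
    unfolding W_green_entry_def[abs_def]
    by (rule bounded0_of_columns) (simp add: norm_W_green_column_le)
  assume t: "0 \<le> t" "t < 1"
  have f_eq: "block_op False ?\<alpha>' (block_op False \<alpha> (?f t j)) = ?f t j" for j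
    by (simp add: block_op_adj_left contr)
  show "(green_entry \<alpha> (n - 1) k t, green_entry \<alpha> n k t)
      = theta_mult (adj (of_mat (\<alpha> n))) (W_green_entry \<alpha> (n - 1) k t, W_green_entry \<alpha> n k t)"
    if "odd n"
    using that of_columns_block_op[of n False ?\<alpha>' "\<lambda>j. block_op False \<alpha> (?f t j)"]
    by (simp add: green_entry_def W_green_entry_def of_mat_simps f_eq)
  have forced_eq: "forced (green_entry \<alpha>) n k t
      = of_columns (\<lambda>j. complex_of_real t *s ?f t j n + unit_seq k j n)" for n
    by (simp add: forced_def green_entry_def of_columns_add of_columns_scaleR of_columns_unit_seq)
  show "(W_green_entry \<alpha> (n - 1) k t, W_green_entry \<alpha> n k t)
      = theta_mult (adj (of_mat (\<alpha> n)))
          (forced (green_entry \<alpha>) (n - 1) k t, forced (green_entry \<alpha>) n k t)" if "even n"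
    using that of_columns_block_op[of n True ?\<alpha>'
        "\<lambda>j n. complex_of_real t *s ?f t j n + unit_seq k j n"]
    by (simp add: W_green_entry_def forced_eq of_mat_simps W_green_column_eq[OF t])
qed

end

lemma eq_upto_of_mat:
  fixes A B :: "complex \<Rightarrow> complex^'m^'m"
  assumes D: "D \<in> o[at 0](\<lambda>z. z ^ N)" and le: "\<And>z. op_norm (A z - B z) \<le> norm (D z)"
  shows "eq_upto N (\<lambda>t. of_mat (A (complex_of_real t))) (\<lambda>t. of_mat (B (complex_of_real t)))"
proof (rule eq_upto_dominated)
  show "eventually (\<lambda>t. norm (of_mat (A (complex_of_real t)) - of_mat (B (complex_of_real t)))
      \<le> norm (D (complex_of_real t))) (at_right 0)"
    using le by (simp flip: of_mat_simps)
  have "filterlim complex_of_real (at 0) (at_right 0)"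
    by (rule filterlim_atI) (auto intro!: tendsto_eq_intros simp: eventually_at_filter)
  then have "(\<lambda>t. D (complex_of_real t)) \<in> o[at_right 0](\<lambda>t. complex_of_real t ^ N)"
    by (rule landau_o.small.compose[OF D])
  then show "(\<lambda>t. norm (D (complex_of_real t))) \<in> o[at_right 0](\<lambda>t. t ^ N)"
    by (subst (asm) landau_o.small.norm_iff[symmetric]) (simp add: norm_power flip: power_abs)
qed

lemma
  fixes A B C D :: "complex \<Rightarrow> complex^'m^'m"
  assumes "(\<lambda>z. complex_of_real (op_norm (A z - B z) + op_norm (C z - D z))) \<in> o[at 0](\<lambda>z. z ^ N)"
  shows eq_upto_of_mat_left:
      "eq_upto N (\<lambda>t. of_mat (A (complex_of_real t))) (\<lambda>t. of_mat (B (complex_of_real t)))"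
    and eq_upto_of_mat_right:
      "eq_upto N (\<lambda>t. of_mat (C (complex_of_real t))) (\<lambda>t. of_mat (D (complex_of_real t)))"
proof -
  have nonneg: "0 \<le> op_norm X" for X :: "complex^'m^'m"
    using norm_ge_zero[of "of_mat X"] by (simp add: of_mat_simps)
  show "eq_upto N (\<lambda>t. of_mat (A (complex_of_real t))) (\<lambda>t. of_mat (B (complex_of_real t)))"
    "eq_upto N (\<lambda>t. of_mat (C (complex_of_real t))) (\<lambda>t. of_mat (D (complex_of_real t)))"
    by (rule eq_upto_of_mat[OF assms]; simp add: nonneg del: of_real_add)+
qed

subsection \<open>Uniqueness\<close>

context
  fixes \<alpha>1 \<alpha>2 :: "int \<Rightarrow> complex^'m^'m"
  assumes contr: "\<And>k. op_norm (\<alpha>1 k) < 1" "\<And>k. op_norm (\<alpha>2 k) < 1"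
begin

interpretation green_kernel_pair "\<lambda>n. of_mat (\<alpha>1 n)" "\<lambda>n. of_mat (\<alpha>2 n)"
  "green_entry \<alpha>1" "W_green_entry \<alpha>1" "green_entry \<alpha>2" "W_green_entry \<alpha>2"
  by (intro green_kernel_pair.intro green_kernel_green_entry contr)

lemma verblunsky_eq_if_g_h_eq:
  assumes "invertible (h_fun \<alpha>1 0 k0) \<or> invertible (h_fun \<alpha>2 0 k0)"
    and small: "(\<lambda>z. complex_of_real (op_norm (g_fun \<alpha>1 z k0 - g_fun \<alpha>2 z k0) +
      op_norm (h_fun \<alpha>1 z k0 - h_fun \<alpha>2 z k0))) \<in> o[at 0](\<lambda>z. z ^ N)"
    and "k0 - int N \<le> k" "k \<le> k0 + int N + 1"
  shows "\<alpha>1 k = \<alpha>2 k"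
proof -
  have "of_mat (\<alpha>1 k) = of_mat (\<alpha>2 k)"
    using assms(1,3,4) eq_upto_of_mat_left[OF small] eq_upto_of_mat_right[OF small]
    by (intro coefficients_eq_if_green_eq[of N k0 k])
       (simp_all add: of_mat_g_fun of_mat_h_fun invertible_h_fun_iff)
  then show ?thesis
    by (simp add: of_mat_inject)
qed

lemma verblunsky_eq_if_diagonals_eq:
  assumes "\<alpha>1 k0 = \<alpha>2 k0" "invertible (\<alpha>1 k0)"
    and small: "(\<lambda>z. complex_of_real (op_norm (g_fun \<alpha>1 z (k0 - 1) - g_fun \<alpha>2 z (k0 - 1)) +
      op_norm (g_fun \<alpha>1 z k0 - g_fun \<alpha>2 z k0))) \<in> o[at 0](\<lambda>z. z ^ N)"
    and "k0 - int N - 1 \<le> k" "k \<le> k0 + int N + 1"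
  shows "\<alpha>1 k = \<alpha>2 k"
proof -
  have "of_mat (\<alpha>1 k) = of_mat (\<alpha>2 k)"
    using assms(1,2,4,5) eq_upto_of_mat_left[OF small] eq_upto_of_mat_right[OF small]
    by (intro coefficients_eq_if_diagonals_eq[of N k0 k])
       (simp_all add: of_mat_g_fun ring_unit_of_mat_iff)
  then show ?thesis
    by (simp add: of_mat_inject)
qed

end

theorem theorem1p4:
  fixes \<alpha>1 \<alpha>2 :: "int \<Rightarrow> complex^'m^'m" and k0 :: int and N :: nat
  assumes "\<And>k. op_norm (\<alpha>1 k) < 1" and "\<And>k. op_norm (\<alpha>2 k) < 1"
  shows
    "((invertible (h_fun \<alpha>1 0 k0) \<or> invertible (h_fun \<alpha>2 0 k0)) \<and>
      (\<lambda>z. complex_of_real (op_norm (g_fun \<alpha>1 z k0 - g_fun \<alpha>2 z k0) +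
                            op_norm (h_fun \<alpha>1 z k0 - h_fun \<alpha>2 z k0)))
        \<in> o[at 0](\<lambda>z. z ^ N)
      \<longrightarrow> (\<forall>k. k0 - int N \<le> k \<and> k \<le> k0 + int N + 1 \<longrightarrow> \<alpha>1 k = \<alpha>2 k))
     \<and>
     (\<alpha>1 k0 = \<alpha>2 k0 \<and> invertible (\<alpha>1 k0) \<and>
      (\<lambda>z. complex_of_real (op_norm (g_fun \<alpha>1 z (k0 - 1) - g_fun \<alpha>2 z (k0 - 1)) +
                            op_norm (g_fun \<alpha>1 z k0 - g_fun \<alpha>2 z k0)))
        \<in> o[at 0](\<lambda>z. z ^ N)
      \<longrightarrow> (\<forall>k. k0 - int N - 1 \<le> k \<and> k \<le> k0 + int N + 1 \<longrightarrow> \<alpha>1 k = \<alpha>2 k))"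
  using verblunsky_eq_if_g_h_eq[of \<alpha>1 \<alpha>2, OF assms]
    verblunsky_eq_if_diagonals_eq[of \<alpha>1 \<alpha>2, OF assms] by blast

end
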